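(* Let $G_0,G_1\in M_n(\mathbb{R})$ be two kernels of $1$-permanental vectors and let $\{G_\alpha:\alpha\in[0,1]\}$ be an interpolation between them such that for every $\alpha\in[0,1]$, $G_\alpha$ is an inverse M-matrix with a positive definite symmetric part, and such that for all $i,j\in[n]$ the map $\alpha\mapsto G_{\alpha,ij}$ is of class $C^1([0,1])$ with $\frac{d}{d\alpha}G_{\alpha,ij}$ of constant sign. Let $\ell_0,\ell_1$ be $1$-permanental vectors with kernels $G_0,G_1$ respectively. If $G_{1,ii}\le G_{0,ii}$ for all $i\in[n]$ and $G_{1,ij}\ge G_{0,ij}$ for all $i\ne j$, then $$\sup_i\ell_{0,i}\succeq\sup_i\ell_{1,i}.$$
   Context: $[n]=\{1,\dots,n\}$, $\mathbb{R}_+=[0,\infty)$, $|A|$ is the determinant of $A$; the symmetric part of $A$ is $\frac12(A+A^T)$. The interpolation has endpoints $G_0$ at $\alpha=0$ and $G_1$ at $\alpha=1$. A random vector $\ell\in\mathbb{R}_+^n$ is a $1$-permanental vector with kernel $G\in M_n(\mathbb{R})$ if for every $\lambda\in\mathbb{R}_+^n$, $\mathbb{E}[e^{-\langle\lambda,\ell\rangle}]=|I+\Lambda G|^{-1}$, where $\Lambda=\mathrm{diag}(\lambda_1,\dots,\lambda_n)$. An M-matrix is a real matrix of the form $sI-B$ with $B$ entrywise nonnegative and $s\ge\rho(B)$, $\rho$ the spectral radius. An inverse M-matrix is the inverse of an invertible M-matrix. For real random variables, $X\succeq Y$ means (first-order) stochastic domination: $\mathbb{P}(X\ge x)\ge\mathbb{P}(Y\ge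 x)$ for all $x\in\mathbb{R}$. *)

theory Defs
  imports "HOL-Probability.Probability"
begin

definition diag_matrix :: "real^'n \<Rightarrow> real^'n^'n" where
  "diag_matrix v = (\<chi> i j. if i = j then v $ i else 0)"

definition eigenvalues :: "real^'n^'n \<Rightarrow> complex set" where
  "eigenvalues B = {z. \<exists>v. v \<noteq> 0 \<and> map_matrix complex_of_real B *v v = z *s v}"

definition spectral_radius :: "real^'n^'n \<Rightarrow> real" where
  "spectral_radius B = (SUP z\<in>eigenvalues B. cmod z)"

(* mat s is the scalar matrix with s on the diagonal. *)
definition M_matrix :: "real^'n^'n \<Rightarrow> bool" where
  "M_matrix A \<longleftrightarrow>
     (\<exists>s B. A = mat s - B \<and> (\<forall>i j. 0 \<le> B $ i $ j) \<and> spectral_radius B \<le> s)"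

definition inverse_M_matrix :: "real^'n^'n \<Rightarrow> bool" where
  "inverse_M_matrix G \<longleftrightarrow> (\<exists>A. M_matrix A \<and> invertible A \<and> G = matrix_inv A)"

definition symmetric_part :: "real^'n^'n \<Rightarrow> real^'n^'n" where
  "symmetric_part A = (1/2) *\<^sub>R (A + transpose A)"

definition positive_definite :: "real^'n^'n \<Rightarrow> bool" where
  "positive_definite P \<longleftrightarrow> transpose P = P \<and> (\<forall>x. x \<noteq> 0 \<longrightarrow> 0 < x \<bullet> (P *v x))"

(* The integrand is bounded by 1 almost everywhere, so the Laplace transform is a genuine,
   strictly positive integral; in particular the determinant below cannot vanish when the
   equation holds, and "inverse" is never applied to 0. *)
definition permanental_vector :: "'a measure \<Rightarrow> ('a \<Rightarrow> real^'n) \<Rightarrow> real^'n^'n \<Rightarrow> bool" where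
  "permanental_vector M l G \<longleftrightarrow>
     prob_space M \<and> l \<in> borel_measurable M \<and> (AE \<omega> in M. \<forall>i. 0 \<le> l \<omega> $ i) \<and>
     (\<forall>u. (\<forall>i. 0 \<le> u $ i) \<longrightarrow>
        (\<integral>\<omega>. exp (- (u \<bullet> l \<omega>)) \<partial>M) = inverse (det (mat 1 + diag_matrix u ** G)))"

(* X and Y may live on different probability spaces. *)
definition stochastically_dominates ::
    "'a measure \<Rightarrow> ('a \<Rightarrow> real) \<Rightarrow> 'b measure \<Rightarrow> ('b \<Rightarrow> real) \<Rightarrow> bool" where
  "stochastically_dominates M X N Y \<longleftrightarrow>
     (\<forall>x. \<P>(\<omega> in M. X \<omega> \<ge> x) \<ge> \<P>(\<omega> in N. Y \<omega> \<ge> x))"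

end

theory Submission
  imports Defs
begin

text \<open>
Slepian-type interpolation, carried out on Laplace transforms only, so that no permanental vectors
with kernels strictly between the two endpoints are needed. Write \<open>G\<^sup>-\<^sup>1 = s I - B\<close> with
\<open>B \<ge> 0\<close>, let \<open>x\<close> be the Laplace variable and \<open>K = (G\<^sup>-\<^sup>1 + \<Lambda>)\<^sup>-\<^sup>1\<close>. Since \<open>G \<ge> 0\<close> entrywise, a Neumann series
writes the entries of \<open>K\<close>, and hence the Laplace transform \<open>\<psi> = det (I + \<Lambda> G)\<^sup>-\<^sup>1\<close>, as limits of
polynomials with nonnegative coefficients in the factors \<open>s / (s + x\<^sub>i)\<close>, the Laplace transforms of
exponential variables. The derivatives of \<open>\<psi>\<close> are \<open>\<psi> x\<^sub>i x\<^sub>j K\<^sub>j\<^sub>i\<close> in direction \<open>G\<^sub>i\<^sub>j\<close>, \<open>i \<noteq> j\<close>, and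
\<open>- \<psi> x\<^sub>i (1 - x\<^sub>i K\<^sub>i\<^sub>i)\<close> in direction \<open>G\<^sub>i\<^sub>i\<close>. Test functions \<open>\<Prod>\<^sub>i p (exp (- \<ell>\<^sub>i))\<close> with \<open>p\<close> a nonnegative polynomial
increasing on \<open>[0, 1]\<close> have expectations that are finite linear combinations of values of \<open>\<psi>\<close>,
and the expansion fixes the sign of both kinds of derivatives after this pairing; in the diagonal
case because \<open>1 - x\<^sub>i K\<^sub>i\<^sub>i = s K\<^sub>i\<^sub>i (1 - v)\<close>, where \<open>v\<close> has an expansion free of \<open>x\<^sub>i\<close> and \<open>v 0 \<le> 1\<close>. Choosing
\<open>p\<close> close to a step function gives the comparison of \<open>P(sup\<^sub>i \<ell>\<^sub>i < y)\<close>.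
\<close>

section \<open>Admissible test polynomials\<close>

text \<open>The sequence \<open>a\<close> stands for \<open>p z = (\<Sum>k\<le>m. a k * z ^ k)\<close>; the condition says
\<open>p 0 \<ge> 0\<close> and \<open>z * p' z \<ge> 0\<close>.\<close>

definition admissible :: "nat \<Rightarrow> (nat \<Rightarrow> real) \<Rightarrow> bool" where
  "admissible m a \<longleftrightarrow> 0 \<le> a 0 \<and> (\<forall>z\<in>{0<..1}. 0 \<le> (\<Sum>k\<le>m. real k * a k * z ^ k))"

text \<open>If \<open>q\<close> is the new polynomial, then \<open>s q + z q' = s p\<close>, so that \<open>z\<^sup>s (z q')\<close> has derivative
\<open>s z\<^sup>s p' \<ge> 0\<close>.\<close>

lemma admissible_resolvent:
  fixes s :: nat
  assumes a: "admissible m a" and s: "0 < s"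
  shows "admissible m (\<lambda>k. s / (real s + real k) * a k)"
proof -
  define e where "e z = (\<Sum>k\<le>m. real k * (s / (real s + real k) * a k) * z ^ k)" for z :: real
  have "0 \<le> e z" if z: "0 < z" "z \<le> 1" for z
  proof -
    define F where "F y = (\<Sum>k\<le>m. real k * (s / (real s + real k) * a k) * y ^ (s + k))" for y :: real
    have der: "(F has_real_derivative y ^ (s - 1) * (s * (\<Sum>k\<le>m. real k * a k * y ^ k))) (at y)" for y
    proof -
      have "(F has_real_derivative
          (\<Sum>k\<le>m. real k * (s / (real s + real k) * a k) * ((real s + real k) * y ^ (s + k - 1)))) (at y)"
        unfolding F_def using s
        by (auto intro!: derivative_eq_intros sum.cong simp: add_nonneg_eq_0_iff)
      moreover have "real k * (s / (real s + real k) * a k) * ((real s + real k) * y ^ (s + k - 1))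
          = y ^ (s - 1) * (s * (real k * a k * y ^ k))" for k
      proof -
        have "y ^ (s + k - 1) = y ^ (s - 1) * y ^ k"
          using s by (simp flip: power_add)
        moreover have "real s / (real s + real k) * (real s + real k) = s"
          using s by (simp add: add_nonneg_eq_0_iff)
        ultimately show ?thesis
          by (metis (no_types, opaque_lifting) mult.assoc mult.left_commute)
      qed
      ultimately show ?thesis
        by (simp add: sum_distrib_left)
    qed
    have "F 0 \<le> F z"
    proof (rule DERIV_nonneg_imp_increasing_open[where f = F])
      show "0 \<le> z" using z by simp
      show "\<exists>d. (F has_real_derivative d) (at y) \<and> 0 \<le> d" if "0 < y" "y < z" for y
        using a that z unfolding admissible_def
        by (intro exI[of _ "y ^ (s - 1) * (s * (\<Sum>k\<le>m. real k * a k * y ^ k))"] conjI der) auto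
      show "continuous_on {0..z} F"
        unfolding F_def by (intro continuous_intros)
    qed
    moreover have "F z = z ^ s * e z"
      by (simp add: F_def e_def sum_distrib_left power_add mult_ac)
    moreover have "F 0 = 0"
      using s by (simp add: F_def power_0_left)
    moreover have "0 < z ^ s"
      using z by simp
    ultimately show "0 \<le> e z"
      by (metis mult_le_cancel_left_pos mult_zero_right)
  qed
  then show ?thesis
    using a s by (auto simp: admissible_def e_def)
qed

lemma admissible_resolvent_power:
  fixes s :: nat
  assumes "admissible m a" "0 < s"
  shows "admissible m (\<lambda>k. (s / (real s + real k)) ^ j * a k)"
  using assms(1)
proof (induction j)
  case (Suc j)
  then show ?case
    using admissible_resolvent[OF Suc.IH[OF Suc.prems] assms(2)] by (simp add: mult.assoc)
qed simp

text \<open>The sum is the value at 1 of the polynomial, which increases on [0, 1] from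
  \<open>a 0\<close>.\<close>

lemma admissible_sum_nonneg:
  assumes "admissible m a"
  shows "0 \<le> (\<Sum>k\<le>m. a k)"
proof -
  define p where "p z = (\<Sum>k\<le>m. a k * z ^ k)" for z :: real
  have "p 0 \<le> p 1"
  proof (rule DERIV_nonneg_imp_increasing_open[where f = p])
    show "\<exists>d. (p has_real_derivative d) (at z) \<and> 0 \<le> d" if z: "0 < z" "z < 1" for z
    proof (intro exI conjI)
      show "(p has_real_derivative (\<Sum>k\<le>m. a k * (real k * z ^ (k - 1)))) (at z)"
        unfolding p_def by (auto intro!: derivative_eq_intros sum.cong)
      have "z * (\<Sum>k\<le>m. a k * (real k * z ^ (k - 1))) = (\<Sum>k\<le>m. real k * a k * z ^ k)"
        unfolding sum_distrib_left
        by (intro sum.cong refl) (auto simp: power_eq_if[of z])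
      also have "0 \<le> \<dots>"
        using assms z by (simp add: admissible_def)
      finally show "0 \<le> (\<Sum>k\<le>m. a k * (real k * z ^ (k - 1)))"
        using z by (simp add: zero_le_mult_iff)
    qed
    show "continuous_on {0..1} p"
      unfolding p_def by (intro continuous_intros)
  qed simp
  moreover have "p 0 = a 0"
    by (simp add: p_def power_0_left if_distrib cong: if_cong)
  ultimately show ?thesis
    using assms by (simp add: admissible_def p_def)
qed

text \<open>The one-variable source of all later signs. Powers of \<open>s / (s + k)\<close>
  preserve admissibility. Since \<open>s (1 - s / (s + k)) = k s / (s + k)\<close>, the optional
  factor becomes one more power together with a weight \<open>k\<close>, that is,
  \<open>z q'\<close> at 1.\<close>

lemma admissible_pairing_nonneg:
  fixes s :: nat
  assumes a: "admissible m a" and s: "0 < s"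
  shows "0 \<le> (\<Sum>k\<le>m. a k * ((s / (real s + real k)) ^ j * (if b then 1 - s / (real s + real k) else 1)))"
proof (cases b)
  case False
  then show ?thesis
    using admissible_sum_nonneg[OF admissible_resolvent_power[OF a s]] by (simp add: mult_ac)
next
  case True
  have "admissible m (\<lambda>k. (s / (real s + real k)) ^ Suc j * a k)"
    by (rule admissible_resolvent_power[OF a s])
  then have "0 \<le> (\<Sum>k\<le>m. real k * ((s / (real s + real k)) ^ Suc j * a k) * 1 ^ k)"
    unfolding admissible_def by (drule_tac conjunct2) (drule_tac bspec[of _ _ 1], auto)
  also have "\<dots> = s * (\<Sum>k\<le>m. a k * ((s / (real s + real k)) ^ j * (1 - s / (real s + real k))))"
  proof -
    have "real k * ((s / (real s + real k)) ^ Suc j * a k) * 1 ^ k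
        = s * (a k * ((s / (real s + real k)) ^ j * (1 - s / (real s + real k))))" for k
    proof -
      have "1 - s / (real s + real k) = real k / (s + k)"
        using s by (simp add: field_simps)
      then show ?thesis by simp
    qed
    then show ?thesis by (simp add: sum_distrib_left)
  qed
  finally show ?thesis
    using s True by (simp add: zero_le_mult_iff)
qed

section \<open>The cone generated by exponential Laplace transforms\<close>

text \<open>\<open>U\<close> lists the coordinates on which a member may depend. Limits are
  pointwise and taken only at nonnegative arguments, the only ones that a pairing evaluates.\<close>

inductive_set resolvent_cone :: "real \<Rightarrow> 'n::finite set \<Rightarrow> (real^'n \<Rightarrow> real) set" for s U where
  const: "0 \<le> c \<Longrightarrow> (\<lambda>_. c) \<in> resolvent_cone s U"
| gen: "i \<in> U \<Longrightarrow> f \<in> resolvent_cone s U \<Longrightarrow> (\<lambda>x. s / (s + x $ i) * f x) \<in> resolvent_cone s U"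
| add: "f \<in> resolvent_cone s U \<Longrightarrow> g \<in> resolvent_cone s U \<Longrightarrow> (\<lambda>x. f x + g x) \<in> resolvent_cone s U"
| lim: "(\<And>n::nat. F n \<in> resolvent_cone s U) \<Longrightarrow>
    (\<And>x. (\<And>i. 0 \<le> x $ i) \<Longrightarrow> (\<lambda>n. F n x) \<longlonglongrightarrow> f x) \<Longrightarrow> f \<in> resolvent_cone s U"

lemma resolvent_cone_cong:
  assumes "f \<in> resolvent_cone s U" and "\<And>x. (\<And>i. 0 \<le> x $ i) \<Longrightarrow> g x = f x"
  shows "g \<in> resolvent_cone s U"
  by (rule resolvent_cone.lim[of "\<lambda>_. f"]) (use assms in simp_all)

lemma resolvent_cone_nonneg:
  assumes "f \<in> resolvent_cone s U" "0 < s" "\<And>i. 0 \<le> x $ i"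
  shows "0 \<le> f x"
  using assms
proof (induction rule: resolvent_cone.induct)
  case (gen i f)
  then show ?case
    by (intro mult_nonneg_nonneg divide_nonneg_nonneg add_nonneg_nonneg) auto
next
  case (lim F f)
  then show ?case
    by (intro LIMSEQ_le_const[of "\<lambda>n. F n x" "f x" 0]) auto
qed auto

lemma resolvent_cone_cmult:
  assumes "f \<in> resolvent_cone s U" "0 \<le> c"
  shows "(\<lambda>x. c * f x) \<in> resolvent_cone s U"
  using assms
proof (induction rule: resolvent_cone.induct)
  case (gen i f)
  then show ?case
    using resolvent_cone.gen[of i U "\<lambda>x. c * f x" s] by (simp add: mult_ac)
next
  case (lim F f)
  show ?case
    by (rule resolvent_cone.lim[of "\<lambda>n x. c * F n x"]) (use lim in \<open>auto intro: tendsto_mult_left\<close>)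
qed (simp_all add: resolvent_cone.const resolvent_cone.add distrib_left)

lemma resolvent_cone_mult:
  assumes "f \<in> resolvent_cone s U" "g \<in> resolvent_cone s U"
  shows "(\<lambda>x. f x * g x) \<in> resolvent_cone s U"
  using assms
proof (induction rule: resolvent_cone.induct)
  case (const c)
  then show ?case by (simp add: resolvent_cone_cmult)
next
  case (gen i f)
  then show ?case
    using resolvent_cone.gen[of i U "\<lambda>x. f x * g x" s] by (simp add: mult_ac)
next
  case (lim F f)
  show ?case
    by (rule resolvent_cone.lim[of "\<lambda>n x. F n x * g x"]) (use lim in \<open>auto intro: tendsto_mult_right\<close>)
qed (simp_all add: resolvent_cone.add distrib_right)

lemma resolvent_cone_sum:
  assumes "finite I" "\<And>i. i \<in> I \<Longrightarrow> f i \<in> resolvent_cone s U"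
  shows "(\<lambda>x. \<Sum>i\<in>I. f i x) \<in> resolvent_cone s U"
  using assms by (induction I rule: finite_induct) (simp_all add: resolvent_cone.const resolvent_cone.add)

lemma resolvent_cone_mono:
  assumes "f \<in> resolvent_cone s U" "U \<subseteq> V"
  shows "f \<in> resolvent_cone s V"
  using assms
proof (induction rule: resolvent_cone.induct)
  case (lim F f)
  show ?case
    by (rule resolvent_cone.lim[of F]) (use lim in \<open>auto\<close>)
next
  case (gen i f)
  then show ?case by (intro resolvent_cone.gen) auto
qed (simp_all add: resolvent_cone.const resolvent_cone.add)

text \<open>If \<open>f\<close> is the Laplace transform of \<open>\<ell>\<close> and \<open>p z = (\<Sum>k\<le>m. a k * z ^ k)\<close>, the pairing is the
expectation of \<open>\<Prod>i. p (exp (- \<ell>\<^sub>i))\<close>.\<close>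

definition pairing :: "nat \<Rightarrow> (nat \<Rightarrow> real) \<Rightarrow> (real^'n::finite \<Rightarrow> real) \<Rightarrow> real" where
  "pairing m a f = (\<Sum>k\<in>Pi\<^sub>E UNIV (\<lambda>_. {..m}). (\<Prod>i\<in>UNIV. a (k i)) * f (\<chi> i. real (k i)))"

section \<open>Linearity of the pairing and its sign on the cone\<close>

lemma pairing_add: "pairing m a (\<lambda>x. f x + g x) = pairing m a f + pairing m a g"
  by (simp add: pairing_def distrib_left sum.distrib)

lemma pairing_diff: "pairing m a (\<lambda>x. f x - g x) = pairing m a f - pairing m a g"
  by (simp add: pairing_def right_diff_distrib sum_subtractf)

lemma pairing_cmult: "pairing m a (\<lambda>x. c * f x) = c * pairing m a f"
  by (simp add: pairing_def sum_distrib_left mult_ac)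

lemma pairing_sum: "pairing m a (\<lambda>x. \<Sum>i\<in>I. f i x) = (\<Sum>i\<in>I. pairing m a (f i))"
  unfolding pairing_def sum_distrib_left by (rule sum.swap)

lemma pairing_cong:
  assumes "\<And>x. (\<And>i. 0 \<le> x $ i) \<Longrightarrow> f x = g x"
  shows "pairing m a f = pairing m a g"
  unfolding pairing_def by (intro sum.cong refl arg_cong2[where f = "(*)"] assms) simp

lemma pairing_tendsto:
  assumes "\<And>x. (\<And>i. 0 \<le> x $ i) \<Longrightarrow> (\<lambda>n. F n x) \<longlonglongrightarrow> f x"
  shows "(\<lambda>n. pairing m a (F n)) \<longlonglongrightarrow> pairing m a f"
  unfolding pairing_def by (intro tendsto_intros assms) simp

lemma pairing_prod:
  "pairing m a (\<lambda>x. \<Prod>i\<in>UNIV. u i (x $ i)) = (\<Prod>i\<in>UNIV. \<Sum>k\<le>m. a k * u i (real k))"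
  by (simp add: pairing_def prod_sum_PiE prod.distrib)

text \<open>The exponents \<open>j\<close> carry the induction: a generator raises one of them, and
  a constant leaves a product of sums covered by \<open>admissible_pairing_nonneg\<close>.\<close>

lemma pairing_cone_nonneg_aux:
  fixes s :: nat and f :: "real^'n::finite \<Rightarrow> real"
  assumes "f \<in> resolvent_cone s U" and a: "admissible m a" "0 < s"
  shows "0 \<le> pairing m a (\<lambda>x. f x * (\<Prod>i\<in>UNIV. (s / (s + x $ i)) ^ j i *
    (if i \<in> I then 1 - s / (s + x $ i) else 1)))"
  using assms(1)
proof (induction arbitrary: j rule: resolvent_cone.induct)
  case (const c)
  show ?case
    unfolding pairing_cmult
      pairing_prod[of m a "\<lambda>i y. (s / (s + y)) ^ j i * (if i \<in> I then 1 - s / (s + y) else 1)"]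
    by (intro mult_nonneg_nonneg const prod_nonneg) (use admissible_pairing_nonneg[OF a] in simp)
next
  case (gen i f)
  have "s / (s + x $ i) * f x * (\<Prod>k\<in>UNIV. (s / (s + x $ k)) ^ j k *
      (if k \<in> I then 1 - s / (s + x $ k) else 1)) =
      f x * (\<Prod>k\<in>UNIV. (s / (s + x $ k)) ^ (j(i := Suc (j i))) k *
      (if k \<in> I then 1 - s / (s + x $ k) else 1))" for x :: "real^'n"
    by (simp add: prod.remove[of UNIV i] mult_ac)
  then show ?case
    using gen.IH[of "j(i := Suc (j i))"] by simp
next
  case (add f g)
  then show ?case by (simp add: distrib_right pairing_add)
next
  case (lim F f)
  let ?r = "\<lambda>x::real^'n. \<Prod>i\<in>UNIV. (s / (s + x $ i)) ^ j i *
    (if i \<in> I then 1 - s / (s + x $ i) else 1)"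
  show ?case
  proof (rule LIMSEQ_le_const)
    show "(\<lambda>n. pairing m a (\<lambda>x. F n x * ?r x)) \<longlonglongrightarrow> pairing m a (\<lambda>x. f x * ?r x)"
      by (intro pairing_tendsto tendsto_mult_right lim.hyps)
  qed (use lim.IH in auto)
qed

lemma pairing_cone_nonneg:
  fixes s :: nat and f :: "real^'n::finite \<Rightarrow> real"
  assumes "f \<in> resolvent_cone s U" "admissible m a" "0 < s"
  shows "0 \<le> pairing m a (\<lambda>x. f x * (\<Prod>i\<in>I. 1 - s / (s + x $ i)))"
  using pairing_cone_nonneg_aux[OF assms, of "\<lambda>_. 0" I] by (simp add: prod.If_cases)

text \<open>Coefficients \<open>a\<close> of mixed sign prevent a direct use of the pointwise bound
  \<open>v x \<le> v 0\<close>. Instead, with \<open>f\<close> arbitrary, a generator of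
  \<open>v\<close> is moved into \<open>f\<close> and then dropped.\<close>

lemma pairing_cone_bound:
  fixes s :: nat and f v :: "real^'n::finite \<Rightarrow> real"
  assumes "v \<in> resolvent_cone s (- {i})" "f \<in> resolvent_cone s UNIV" and a: "admissible m a" "0 < s"
  shows "pairing m a (\<lambda>x. f x * v x * (1 - s / (s + x $ i)))
    \<le> v 0 * pairing m a (\<lambda>x. f x * (1 - s / (s + x $ i)))"
  using assms(1,2)
proof (induction arbitrary: f rule: resolvent_cone.induct)
  case (const c)
  show ?case
    unfolding pairing_cmult[symmetric] by (simp add: mult_ac)
next
  case (gen j p)
  have "pairing m a (\<lambda>x. f x * (s / (s + x $ j) * p x) * (1 - s / (s + x $ i)))
      = pairing m a (\<lambda>x. s / (s + x $ j) * f x * p x * (1 - s / (s + x $ i)))"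
    by (simp add: mult_ac)
  also have "\<dots> \<le> p 0 * pairing m a (\<lambda>x. s / (s + x $ j) * f x * (1 - s / (s + x $ i)))"
    by (intro gen resolvent_cone.gen) simp
  also have "\<dots> \<le> p 0 * pairing m a (\<lambda>x. f x * (1 - s / (s + x $ i)))"
  proof (rule mult_left_mono)
    show "0 \<le> p 0"
      using gen a by (intro resolvent_cone_nonneg[OF gen.hyps(2)]) auto
    \<comment> \<open>This pairing is exactly what dropping the generator adds. The product has two
      factors because \<open>j \<noteq> i\<close>.\<close>
    have "0 \<le> pairing m a (\<lambda>x. f x * (\<Prod>k\<in>{i, j}. 1 - s / (s + x $ k)))"
      by (rule pairing_cone_nonneg[OF gen.prems a])
    also have "\<dots> = pairing m a (\<lambda>x. f x * (1 - s / (s + x $ i)))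
        - pairing m a (\<lambda>x. s / (s + x $ j) * f x * (1 - s / (s + x $ i)))"
    proof -
      have "F * ((1 - u) * (1 - w)) = F * (1 - u) - w * F * (1 - u)" for F u w :: real
        by (simp add: algebra_simps)
      then show ?thesis
        unfolding pairing_diff[symmetric] using gen.hyps(1) by (intro pairing_cong) auto
    qed
    finally show "pairing m a (\<lambda>x. s / (s + x $ j) * f x * (1 - s / (s + x $ i)))
        \<le> pairing m a (\<lambda>x. f x * (1 - s / (s + x $ i)))" by simp
  qed
  finally show ?case using a(2) by simp
next
  case (add p q)
  have "pairing m a (\<lambda>x. f x * (p x + q x) * (1 - s / (s + x $ i)))
      = pairing m a (\<lambda>x. f x * p x * (1 - s / (s + x $ i)))
        + pairing m a (\<lambda>x. f x * q x * (1 - s / (s + x $ i)))"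
    unfolding pairing_add[symmetric] by (simp add: algebra_simps)
  then show ?case
    using add.IH(1)[OF add.prems] add.IH(2)[OF add.prems] by (simp add: algebra_simps)
next
  case (lim F p)
  show ?case
  proof (rule LIMSEQ_le)
    show "(\<lambda>n. pairing m a (\<lambda>x. f x * F n x * (1 - s / (s + x $ i))))
        \<longlonglongrightarrow> pairing m a (\<lambda>x. f x * p x * (1 - s / (s + x $ i)))"
      by (intro pairing_tendsto tendsto_intros lim.hyps)
    show "(\<lambda>n. F n 0 * pairing m a (\<lambda>x. f x * (1 - s / (s + x $ i))))
        \<longlonglongrightarrow> p 0 * pairing m a (\<lambda>x. f x * (1 - s / (s + x $ i)))"
      by (intro tendsto_intros lim.hyps) simp
  qed (use lim in auto)
qed

section \<open>Resolvents of nonnegative matrices\<close>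

text \<open>Jacobi's formula. The product rule in the Leibniz expansion yields determinants with row
  \<open>i\<close> replaced by \<open>X' $ i\<close>. Written as a combination of the rows of
  \<open>X z\<close> with coefficients \<open>X' $ i v* K\<close>, this row contributes only its
  \<open>i\<close>-th coefficient.\<close>

lemma has_real_derivative_det:
  fixes X :: "real \<Rightarrow> real^'n^'n"
  assumes X: "\<And>i j. ((\<lambda>u. X u $ i $ j) has_real_derivative X' $ i $ j) (at z)"
    and K: "X z ** K = mat 1"
  shows "((\<lambda>u. det (X u)) has_real_derivative
    det (X z) * (\<Sum>i\<in>UNIV. \<Sum>j\<in>UNIV. X' $ i $ j * K $ j $ i)) (at z)"
proof -
  have KX: "K ** X z = mat 1"
    using K matrix_left_right_inverse by blast
  have row: "det (\<chi> k. if k = i then X' $ i else X z $ k)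
      = det (X z) * (\<Sum>j\<in>UNIV. X' $ i $ j * K $ j $ i)" for i
  proof -
    have "(\<Sum>l\<in>UNIV. (X' $ i v* K) $ l *s row l (X z)) = (X' $ i v* K) v* X z"
      by (simp add: vec_eq_iff vector_matrix_mult_def row_def mult.commute)
    also have "\<dots> = X' $ i"
      by (simp add: vector_matrix_mul_assoc KX)
    finally show ?thesis
      using cramer_lemma_transpose[of i "X' $ i v* K" "X z"]
      by (simp add: row_def vector_matrix_mult_def mult.commute cong: if_cong)
  qed
  have "((\<lambda>u. det (X u)) has_real_derivative
      (\<Sum>p | p permutes UNIV. of_int (sign p) *
        (\<Sum>i\<in>UNIV. X' $ i $ p i * (\<Prod>k\<in>UNIV - {i}. X z $ k $ p k)))) (at z)"
    unfolding det_def by (intro DERIV_sum DERIV_cmult has_field_derivative_prod X)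
  also have "(\<Sum>p | p permutes UNIV. of_int (sign p) *
        (\<Sum>i\<in>UNIV. X' $ i $ p i * (\<Prod>k\<in>UNIV - {i}. X z $ k $ p k)))
      = (\<Sum>i\<in>UNIV. det (\<chi> k. if k = i then X' $ i else X z $ k))"
  proof -
    have "(\<Prod>k\<in>UNIV. (\<chi> k. if k = i then X' $ i else X z $ k) $ k $ p k)
        = X' $ i $ p i * (\<Prod>k\<in>UNIV - {i}. X z $ k $ p k)" for i p
      by (subst prod.remove[of UNIV i]) (auto intro!: prod.cong)
    then show ?thesis
      unfolding det_def sum_distrib_left by (subst sum.swap) simp
  qed
  finally show ?thesis
    by (simp add: row sum_distrib_left)
qed

text \<open>\<open>s\<close> is a natural number because it serves as an exponent in the proof of
  \<open>admissible_resolvent\<close>. The condition on the entries of \<open>G\<close> is derived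
  for inverse M-matrices further below.\<close>

locale resolvent_setup =
  fixes s :: nat and A G B :: "real^'n::finite^'n"
  assumes s_pos: "0 < s"
    and A_eq: "A = mat (real s) - B"
    and B_nonneg: "\<And>i j. 0 \<le> B $ i $ j"
    and G_nonneg: "\<And>i j. 0 \<le> G $ i $ j"
    and A_G: "A ** G = mat 1"
begin

text \<open>\<open>M UNIV x\<close> is \<open>A + diag_matrix x\<close>. The columns outside \<open>U\<close> are replaced by multiples of unit
vectors, so that Cramer's rule relates the determinants for \<open>U\<close> and \<open>insert i U\<close>.\<close>

definition M :: "'n set \<Rightarrow> real^'n \<Rightarrow> real^'n^'n" where
  "M U x = (\<chi> a b. (if a = b then s + (if b \<in> U then x $ b else 0) else 0)
    - (if b \<in> U then B $ a $ b else 0))"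

text \<open>Partial sums of the Neumann series of the inverse of \<open>M U x\<close>. They increase and are dominated
by \<open>G\<close>, which replaces any spectral argument.\<close>

primrec K_approx :: "'n set \<Rightarrow> nat \<Rightarrow> real^'n \<Rightarrow> real^'n^'n" where
  "K_approx U 0 x = 0"
| "K_approx U (Suc n) x = (\<chi> a b. (if a \<in> U then s / (s + x $ a) else 1) *
    (1 / s * ((if a = b then 1 else 0) + (\<Sum>c\<in>U. B $ a $ c * K_approx U n x $ c $ b))))"

definition K :: "'n set \<Rightarrow> real^'n \<Rightarrow> real^'n^'n" where
  "K U x = (\<chi> a b. lim (\<lambda>n. K_approx U n x $ a $ b))"

lemma K_approx_cone: "(\<lambda>x. K_approx U n x $ a $ b) \<in> resolvent_cone s U"
proof (induction n arbitrary: a)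
  case 0
  show ?case by (simp add: resolvent_cone.const)
next
  case (Suc n)
  have *: "(\<lambda>x. 1 / s * ((if a = b then 1 else 0) +
      (\<Sum>c\<in>U. B $ a $ c * K_approx U n x $ c $ b))) \<in> resolvent_cone s U"
    by (intro resolvent_cone_cmult resolvent_cone.add resolvent_cone_sum Suc.IH
        resolvent_cone.const B_nonneg) auto
  then show ?case
    using resolvent_cone.gen[OF _ *] by (cases "a \<in> U") auto
qed

lemma resolvent_identity: "s * G $ a $ b = (if a = b then 1 else 0) + (\<Sum>c\<in>UNIV. B $ a $ c * G $ c $ b)"
proof -
  have "(if a = b then 1 else 0) = (\<Sum>c\<in>UNIV. (if a = c then s * G $ c $ b else 0) - B $ a $ c * G $ c $ b)"
    using arg_cong[OF A_G, of "\<lambda>m. m $ a $ b"]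
    by (simp add: A_eq matrix_matrix_mult_def mat_def left_diff_distrib
        if_distrib[of "\<lambda>x. x * _"] cong: if_cong)
  then show ?thesis by (simp add: sum_subtractf)
qed

section \<open>The resolvent at a nonnegative argument\<close>

context
  fixes x :: "real^'n"
  assumes x: "\<And>i. 0 \<le> x $ i"
begin

lemma K_approx_nonneg: "0 \<le> K_approx U n x $ a $ b"
  using resolvent_cone_nonneg[OF K_approx_cone] x s_pos by simp

text \<open>\<open>G\<close> is a fixed point of the iteration for \<open>U = UNIV\<close> and
  \<open>x = 0\<close>; other \<open>U\<close> and \<open>x\<close> only omit nonnegative terms or
  insert factors at most 1.\<close>

lemma K_approx_le: "K_approx U n x $ a $ b \<le> G $ a $ b"
proof (induction n arbitrary: a)
  case 0
  show ?case by (simp add: G_nonneg)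
next
  case (Suc n)
  have "K_approx U (Suc n) x $ a $ b
      \<le> 1 * (1 / s * ((if a = b then 1 else 0) + (\<Sum>c\<in>UNIV. B $ a $ c * G $ c $ b)))"
    unfolding K_approx.simps vec_lambda_beta
  proof (intro mult_mono add_mono order_refl)
    show "(if a \<in> U then s / (s + x $ a) else 1) \<le> 1"
      using s_pos x[of a] by simp
    have "(\<Sum>c\<in>U. B $ a $ c * K_approx U n x $ c $ b) \<le> (\<Sum>c\<in>U. B $ a $ c * G $ c $ b)"
      by (intro sum_mono mult_left_mono Suc.IH B_nonneg)
    also have "\<dots> \<le> (\<Sum>c\<in>UNIV. B $ a $ c * G $ c $ b)"
      by (intro sum_mono2) (auto simp: B_nonneg G_nonneg)
    finally show "(\<Sum>c\<in>U. B $ a $ c * K_approx U n x $ c $ b)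
      \<le> (\<Sum>c\<in>UNIV. B $ a $ c * G $ c $ b)" .
  qed (use s_pos in \<open>auto intro!: divide_nonneg_nonneg mult_nonneg_nonneg add_nonneg_nonneg
      sum_nonneg B_nonneg K_approx_nonneg\<close>)
  also have "\<dots> = G $ a $ b"
    using s_pos resolvent_identity[of a b] by (simp add: field_simps)
  finally show ?case .
qed

lemma K_approx_mono: "K_approx U n x $ a $ b \<le> K_approx U (Suc n) x $ a $ b"
proof (induction n arbitrary: a)
  case 0
  show ?case using K_approx_nonneg[of U "Suc 0"] by simp
next
  case (Suc n)
  show ?case
    by (subst (1 2) K_approx.simps(2), unfold vec_lambda_beta)
      (intro mult_left_mono add_left_mono sum_mono Suc.IH B_nonneg, use x s_pos in auto)
qed

lemma K_approx_tendsto: "(\<lambda>n. K_approx U n x $ a $ b) \<longlonglongrightarrow> K U x $ a $ b"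
proof -
  have "incseq (\<lambda>n. K_approx U n x $ a $ b)"
    by (rule incseq_SucI) (rule K_approx_mono)
  then obtain L where "(\<lambda>n. K_approx U n x $ a $ b) \<longlonglongrightarrow> L"
    by (rule incseq_convergent[where B = "G $ a $ b"]) (simp add: K_approx_le)
  then show ?thesis
    by (simp add: K_def limI)
qed

text \<open>The limit of the recursion is a fixed-point equation, which is this matrix equation read
  entrywise.\<close>

lemma M_K: "M U x ** K U x = mat 1"
proof -
  have "(M U x ** K U x) $ a $ b = (mat 1 :: real^'n^'n) $ a $ b" for a b
  proof -
    let ?t = "if a \<in> U then s / (s + x $ a) else 1"
    have "(\<lambda>n. K_approx U (Suc n) x $ a $ b) \<longlonglongrightarrow> ?t *
        (1 / s * ((if a = b then 1 else 0) + (\<Sum>c\<in>U. B $ a $ c * K U x $ c $ b)))"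
      unfolding K_approx.simps vec_lambda_beta by (intro tendsto_intros K_approx_tendsto)
    then have "K U x $ a $ b = ?t *
        (1 / s * ((if a = b then 1 else 0) + (\<Sum>c\<in>U. B $ a $ c * K U x $ c $ b)))"
      using LIMSEQ_Suc[OF K_approx_tendsto[of U a b]] LIMSEQ_unique by blast
    moreover have "s + x $ a \<noteq> 0"
      using x[of a] s_pos by (simp add: add_nonneg_eq_0_iff)
    ultimately have eq: "(s + (if a \<in> U then x $ a else 0)) * K U x $ a $ b
        = (if a = b then 1 else 0) + (\<Sum>c\<in>U. B $ a $ c * K U x $ c $ b)"
      using s_pos by (simp add: divide_simps split: if_splits) (simp_all add: mult_ac)
    have "(M U x ** K U x) $ a $ b = (\<Sum>c\<in>UNIV. (if a = c then (s + (if c \<in> U then x $ c else 0))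
          * K U x $ c $ b else 0) - (if c \<in> U then B $ a $ c * K U x $ c $ b else 0))"
      by (simp add: matrix_matrix_mult_def M_def left_diff_distrib if_distrib[of "\<lambda>x. x * _"] cong: if_cong)
    also have "\<dots> = (s + (if a \<in> U then x $ a else 0)) * K U x $ a $ b
        - (\<Sum>c\<in>U. B $ a $ c * K U x $ c $ b)"
      by (simp add: sum_subtractf flip: sum.inter_filter)
    finally show ?thesis
      using eq by (simp add: mat_def)
  qed
  then show ?thesis by (simp add: vec_eq_iff)
qed

lemma K_M: "K U x ** M U x = mat 1"
  using M_K matrix_left_right_inverse by blast

lemma det_M_nz: "det (M U x) \<noteq> 0"
  using M_K invertible_det_nz invertible_right_inverse by blast

lemma inverse_det_M_insert:
  assumes "i \<notin> U"
  shows "inverse (det (M (insert i U) x)) = s * K (insert i U) x $ i $ i * inverse (det (M U x))"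
proof -
  let ?M = "M (insert i U) x" and ?K = "K (insert i U) x"
  let ?R = "(\<chi> a b. if b = i then axis i 1 $ a else ?M $ a $ b) :: real^'n^'n"
  have "?M *v column i ?K = column i (?M ** ?K)"
    by (simp add: vec_eq_iff column_def matrix_vector_mult_def matrix_matrix_mult_def)
  also have "\<dots> = axis i 1"
    by (simp add: M_K vec_eq_iff column_def mat_def axis_def)
  finally have "?K $ i $ i = det ?R / det ?M"
    using cramer[OF det_M_nz, of "insert i U" "column i ?K" "axis i 1"]
    by (simp add: vec_eq_iff column_def)
  \<comment> \<open>As \<open>i \<notin> U\<close>, column \<open>i\<close> of \<open>M U x\<close>
    is \<open>s\<close> times a unit vector, and the other columns are those of \<open>?M\<close>.
    Transposing turns the column factor into a row factor.\<close>
  moreover have "det (M U x) = s * det ?R"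
  proof -
    have "transpose (M U x) = (\<chi> a. if a = i then real s *s axis i 1 else transpose ?M $ a)"
      using assms by (auto simp: vec_eq_iff transpose_def M_def axis_def)
    moreover have "transpose ?R = (\<chi> a. if a = i then axis i 1 else transpose ?M $ a)"
      by (auto simp: vec_eq_iff transpose_def)
    ultimately show ?thesis
      using det_row_mul[of i "real s" "\<lambda>_. axis i 1" "\<lambda>a. transpose ?M $ a"]
      by (metis (no_types, lifting) det_transpose)
  qed
  ultimately show ?thesis
    using det_M_nz[of U] det_M_nz[of "insert i U"] by (simp add: field_simps)
qed

lemma K_left: "(s + x $ a) * K UNIV x $ a $ b
    = (if a = b then 1 else 0) + (\<Sum>c\<in>UNIV. B $ a $ c * K UNIV x $ c $ b)"
proof -
  have "(if a = b then 1 else 0) = (\<Sum>c\<in>UNIV. (if a = c then (s + x $ c) * K UNIV x $ c $ b else 0)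
      - B $ a $ c * K UNIV x $ c $ b)"
    using arg_cong[OF M_K[of UNIV], of "\<lambda>m. m $ a $ b"]
    by (simp add: matrix_matrix_mult_def M_def mat_def left_diff_distrib
        if_distrib[of "\<lambda>x. x * _"] cong: if_cong)
  then show ?thesis by (simp add: sum_subtractf)
qed

lemma K_right: "(s + x $ b) * K UNIV x $ a $ b
    = (if a = b then 1 else 0) + (\<Sum>c\<in>UNIV. K UNIV x $ a $ c * B $ c $ b)"
proof -
  have "(if a = b then 1 else 0) = (\<Sum>c\<in>UNIV. (if c = b then (s + x $ c) * K UNIV x $ a $ c else 0)
      - K UNIV x $ a $ c * B $ c $ b)"
    using arg_cong[OF K_M[of UNIV], of "\<lambda>m. m $ a $ b"]
    by (simp add: matrix_matrix_mult_def M_def mat_def right_diff_distrib mult.commute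
        if_distrib[of "\<lambda>x. _ * x"] cong: if_cong)
  then show ?thesis by (simp add: sum_subtractf)
qed

text \<open>The sum on the right does not depend on \<open>x $ i\<close>.\<close>

lemma one_minus_K_diag:
  "1 - x $ i * K UNIV x $ i $ i
    = s * K UNIV x $ i $ i * (1 - (\<Sum>c\<in>UNIV. K (- {i}) x $ i $ c * B $ c $ i))"
proof -
  let ?J = "- {i}"
  let ?k = "K UNIV x $ i $ i" and ?v = "\<Sum>c\<in>UNIV. K (- {i}) x $ i $ c * B $ c $ i"
  \<comment> \<open>The two matrices differ only in column \<open>i\<close>. Entry
    \<open>(i, i)\<close> of \<open>K ?J x ** M ?J x ** K UNIV x\<close> is then computed in two
    ways.\<close>
  have M: "M ?J x $ a $ b = M UNIV x $ a $ b + (if b = i then B $ a $ i - (if a = i then x $ i else 0) else 0)" for a b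
    by (simp add: M_def)
  have "(M ?J x ** K UNIV x) $ a $ i = (if a = i then 1 - x $ i * ?k else 0) + B $ a $ i * ?k" for a
  proof -
    have "(M ?J x ** K UNIV x) $ a $ i = (M UNIV x ** K UNIV x) $ a $ i
        + (B $ a $ i - (if a = i then x $ i else 0)) * ?k"
      by (simp add: matrix_matrix_mult_def M distrib_right sum.distrib
          if_distrib[of "\<lambda>x. x * _"] cong: if_cong)
    then show ?thesis by (simp add: M_K mat_def left_diff_distrib)
  qed
  then have "(K ?J x ** (M ?J x ** K UNIV x)) $ i $ i
      = (\<Sum>a\<in>UNIV. (if a = i then K ?J x $ i $ a * (1 - x $ i * ?k) else 0) + K ?J x $ i $ a * B $ a $ i * ?k)"
    unfolding matrix_matrix_mult_def[of "K ?J x"]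
    by (simp add: distrib_left mult_ac if_distrib[of "\<lambda>x. _ * x"] cong: if_cong)
  also have "\<dots> = K ?J x $ i $ i * (1 - x $ i * ?k) + ?v * ?k"
    by (simp add: sum.distrib sum_distrib_right)
  finally have "?k = K ?J x $ i $ i * (1 - x $ i * ?k) + ?v * ?k"
    by (simp add: matrix_mul_assoc K_M)
  from arg_cong[OF this, of "(*) (real s)"]
  have "s * ?k = s * K ?J x $ i $ i * (1 - x $ i * ?k) + s * (?v * ?k)"
    by (simp only: distrib_left mult.assoc)
  \<comment> \<open>Column \<open>i\<close> of \<open>M ?J x\<close> is \<open>s\<close> times a
    unit vector.\<close>
  moreover have "s * K ?J x $ i $ i = 1"
  proof -
    have "(\<Sum>c\<in>UNIV. if c = i then s * K ?J x $ i $ c else 0) = 1"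
      using arg_cong[OF K_M[of ?J], of "\<lambda>m. m $ i $ i"]
      by (simp add: matrix_matrix_mult_def M_def mat_def mult.commute
          if_distrib[of "\<lambda>x. x * _"] cong: if_cong)
    then show ?thesis by simp
  qed
  ultimately show ?thesis
    by (simp add: algebra_simps)
qed

lemma M_UNIV_G: "M UNIV x ** G = mat 1 + diag_matrix x ** G"
proof -
  have "M UNIV x = A + diag_matrix x"
    by (simp add: vec_eq_iff M_def A_eq mat_def diag_matrix_def)
  moreover have "(A + diag_matrix x) ** G = A ** G + diag_matrix x ** G"
    by (simp add: vec_eq_iff matrix_matrix_mult_def distrib_right sum.distrib)
  ultimately show ?thesis
    by (simp add: A_G)
qed

lemma laplace_eq:
  "inverse (det (mat 1 + diag_matrix x ** G)) = det A * inverse (det (M UNIV x))"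
proof -
  have "det A * det G = 1"
    using arg_cong[OF A_G, of det] by (simp add: det_mul)
  then have "inverse (det G) = det A"
    by (metis inverse_unique mult.commute)
  then show ?thesis
    by (simp add: det_mul flip: M_UNIV_G)
qed

end

section \<open>Cone membership of the transform and signs of its paired derivatives\<close>

definition laplace :: "real^'n \<Rightarrow> real" where
  "laplace x = inverse (det (mat 1 + diag_matrix x ** G))"

lemma K_cone: "(\<lambda>x. K U x $ a $ b) \<in> resolvent_cone s U"
  by (rule resolvent_cone.lim[of "\<lambda>n x. K_approx U n x $ a $ b"])
    (simp_all add: K_approx_cone K_approx_tendsto)

text \<open>Columns are switched on one at a time, starting from \<open>s I\<close>; each
  contributes a factor \<open>s * K (insert i U) x $ i $ i\<close> from the cone.\<close>

lemma inverse_det_M_cone: "(\<lambda>x. inverse (det (M U x))) \<in> resolvent_cone s UNIV"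
proof (induction U rule: finite_induct[OF finite])
  case 1
  have "det (M {} x) = real s ^ CARD('n)" for x
    by (subst det_diagonal) (auto simp: M_def)
  then show ?case by (simp add: resolvent_cone.const)
next
  case (2 i U)
  have "(\<lambda>x. s * (K (insert i U) x $ i $ i * inverse (det (M U x)))) \<in> resolvent_cone s UNIV"
    by (intro resolvent_cone_cmult resolvent_cone_mult 2 resolvent_cone_mono[OF K_cone]) auto
  then show ?case
    by (rule resolvent_cone_cong) (simp add: inverse_det_M_insert 2 mult.assoc)
qed

lemma laplace_cone: "laplace \<in> resolvent_cone s UNIV"
proof -
  \<comment> \<open>The sign of \<open>det A\<close> comes from the cone itself, evaluated at
    0.\<close>
  have "0 \<le> inverse (det (M UNIV 0))"
    using resolvent_cone_nonneg[OF inverse_det_M_cone, of 0] s_pos by simp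
  moreover have "M UNIV 0 = A"
    by (simp add: vec_eq_iff M_def A_eq mat_def)
  ultimately have "(\<lambda>x. det A * inverse (det (M UNIV x))) \<in> resolvent_cone s UNIV"
    by (intro resolvent_cone_cmult inverse_det_M_cone) simp
  then show ?thesis
    by (rule resolvent_cone_cong) (simp add: laplace_def laplace_eq)
qed

lemma one_minus_resolvent: "0 \<le> y \<Longrightarrow> 1 - s / (s + y) = y / (s + y)"
  using s_pos by (simp add: field_simps add_nonneg_eq_0_iff)

text \<open>The function equals \<open>f x * (1 - s / (s + x $ i)) * (1 - v x)\<close> with
  \<open>f\<close> and \<open>v\<close> in the cone and \<open>v\<close> free of
  \<open>x $ i\<close>. By \<open>pairing_cone_bound\<close>, replacing \<open>v x\<close> by
  \<open>v 0 \<le> 1\<close> gives a lower bound.\<close>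

lemma pairing_diagonal:
  assumes a: "admissible m a"
  shows "0 \<le> pairing m a (\<lambda>x. laplace x * (x $ i * (1 - x $ i * K UNIV x $ i $ i)))"
proof -
  define f where "f x = s * (laplace x * (1 + (\<Sum>c\<in>UNIV. B $ i $ c * K UNIV x $ c $ i)))" for x
  define v where "v x = (\<Sum>c\<in>UNIV. K (- {i}) x $ i $ c * B $ c $ i)" for x
  have f: "f \<in> resolvent_cone s UNIV"
    unfolding f_def
    by (intro resolvent_cone_cmult resolvent_cone_mult laplace_cone resolvent_cone.add
        resolvent_cone.const resolvent_cone_sum K_cone B_nonneg) auto
  have v: "v \<in> resolvent_cone s (- {i})"
    unfolding v_def mult.commute[of _ "B $ _ $ _"]
    by (intro resolvent_cone_cmult resolvent_cone_sum K_cone B_nonneg) auto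
  \<comment> \<open>At the argument 0, \<open>one_minus_K_diag\<close> reads
    \<open>1 = s * K UNIV 0 $ i $ i * (1 - v 0)\<close>, where the diagonal entry is
    nonnegative.\<close>
  have v0: "v 0 \<le> 1"
  proof (rule ccontr)
    assume "\<not> v 0 \<le> 1"
    moreover have "0 \<le> K UNIV 0 $ i $ i"
      using resolvent_cone_nonneg[OF K_cone] s_pos by simp
    ultimately have "s * K UNIV 0 $ i $ i * (1 - v 0) \<le> 0"
      by (intro mult_nonneg_nonpos) auto
    then show False
      using one_minus_K_diag[of 0 i] by (simp add: v_def)
  qed
  have "pairing m a (\<lambda>x. laplace x * (x $ i * (1 - x $ i * K UNIV x $ i $ i)))
      = pairing m a (\<lambda>x. f x * (1 - s / (s + x $ i)) - f x * v x * (1 - s / (s + x $ i)))"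
  proof (rule pairing_cong)
    fix x :: "real^'n"
    assume x: "\<And>i. 0 \<le> x $ i"
    let ?S = "1 + (\<Sum>c\<in>UNIV. B $ i $ c * K UNIV x $ c $ i)"
    have pos: "s + x $ i \<noteq> 0"
      using x[of i] s_pos by (simp add: add_nonneg_eq_0_iff)
    have alg: "l * (q * (t * S) * (1 - w)) = q * (l * S) * t - q * (l * S) * w * t" for l q t S w :: real
      by (simp add: algebra_simps)
    have *: "x $ i * K UNIV x $ i $ i = (1 - s / (s + x $ i)) * ?S"
      using K_left[OF x, of i i] pos by (simp add: one_minus_resolvent x field_simps)
    have "laplace x * (x $ i * (1 - x $ i * K UNIV x $ i $ i))
        = laplace x * (s * (x $ i * K UNIV x $ i $ i) * (1 - v x))"
      unfolding one_minus_K_diag[OF x] v_def by (simp only: mult_ac)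
    then have "laplace x * (x $ i * (1 - x $ i * K UNIV x $ i $ i))
        = laplace x * (s * ((1 - s / (s + x $ i)) * ?S) * (1 - v x))"
      by (simp only: *)
    then show "laplace x * (x $ i * (1 - x $ i * K UNIV x $ i $ i))
        = f x * (1 - s / (s + x $ i)) - f x * v x * (1 - s / (s + x $ i))"
      by (simp only: f_def alg)
  qed
  also have "\<dots> = pairing m a (\<lambda>x. f x * (1 - s / (s + x $ i)))
      - pairing m a (\<lambda>x. f x * v x * (1 - s / (s + x $ i)))"
    by (rule pairing_diff)
  finally have "pairing m a (\<lambda>x. laplace x * (x $ i * (1 - x $ i * K UNIV x $ i $ i)))
      \<ge> (1 - v 0) * pairing m a (\<lambda>x. f x * (1 - s / (s + x $ i)))"
    using pairing_cone_bound[OF v f a s_pos] by (simp add: algebra_simps)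
  moreover have "0 \<le> (1 - v 0) * pairing m a (\<lambda>x. f x * (1 - s / (s + x $ i)))"
    using v0 pairing_cone_nonneg[OF f a s_pos, of "{i}"] by simp
  ultimately show ?thesis by linarith
qed

text \<open>\<open>K_left\<close> extracts the factor \<open>1 - s / (s + x $ j)\<close>, without a
  unit term because \<open>i \<noteq> j\<close>; \<open>K_right\<close> then extracts the one for
  \<open>i\<close>. What remains is in the cone.\<close>

lemma pairing_off_diagonal:
  assumes a: "admissible m a" and ij: "i \<noteq> j"
  shows "0 \<le> pairing m a (\<lambda>x. laplace x * (x $ i * (x $ j * K UNIV x $ j $ i)))"
proof -
  define f where "f x = laplace x * (\<Sum>c\<in>UNIV. B $ j $ c *
    ((if c = i then 1 else 0) + (\<Sum>d\<in>UNIV. B $ d $ i * K UNIV x $ c $ d)))" for x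
  have f: "f \<in> resolvent_cone s UNIV"
    unfolding f_def
    by (intro resolvent_cone_cmult resolvent_cone_mult laplace_cone resolvent_cone.add
        resolvent_cone.const resolvent_cone_sum K_cone B_nonneg) auto
  have "pairing m a (\<lambda>x. laplace x * (x $ i * (x $ j * K UNIV x $ j $ i)))
      = pairing m a (\<lambda>x. f x * (\<Prod>k\<in>{i, j}. 1 - s / (s + x $ k)))"
  proof (rule pairing_cong)
    fix x :: "real^'n"
    assume x: "\<And>i. 0 \<le> x $ i"
    have pos: "s + x $ k \<noteq> 0" for k
      using x[of k] s_pos by (simp add: add_nonneg_eq_0_iff)
    have j: "x $ j * K UNIV x $ j $ i = (1 - s / (s + x $ j)) * (\<Sum>c\<in>UNIV. B $ j $ c * K UNIV x $ c $ i)"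
      using K_left[OF x, of j i] pos[of j] ij by (simp add: one_minus_resolvent x field_simps)
    have i: "x $ i * K UNIV x $ c $ i = (1 - s / (s + x $ i)) *
        ((if c = i then 1 else 0) + (\<Sum>d\<in>UNIV. B $ d $ i * K UNIV x $ c $ d))" for c
      using K_right[OF x, of i c] pos[of i] by (simp add: one_minus_resolvent x field_simps)
    have "x $ i * (x $ j * K UNIV x $ j $ i)
        = (1 - s / (s + x $ j)) * (\<Sum>c\<in>UNIV. B $ j $ c * (x $ i * K UNIV x $ c $ i))"
      unfolding j sum_distrib_left by (simp only: mult_ac)
    also have "\<dots> = (1 - s / (s + x $ j)) * ((1 - s / (s + x $ i)) * (\<Sum>c\<in>UNIV. B $ j $ c *
        ((if c = i then 1 else 0) + (\<Sum>d\<in>UNIV. B $ d $ i * K UNIV x $ c $ d))))"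
      unfolding i sum_distrib_left[of "1 - s / (s + x $ i)"] by (simp only: mult_ac)
    finally show "laplace x * (x $ i * (x $ j * K UNIV x $ j $ i))
        = f x * (\<Prod>k\<in>{i, j}. 1 - s / (s + x $ k))"
      unfolding f_def using ij by (simp only: mult_ac prod.insert prod.empty finite.intros) simp
  qed
  also have "0 \<le> \<dots>"
    by (rule pairing_cone_nonneg[OF f a s_pos])
  finally show ?thesis .
qed

end

section \<open>Inverse M-matrices are nonnegative\<close>

lemma mat_diff_mult_nth:
  fixes B R :: "real^'n::finite^'n"
  shows "((mat q - B) ** R) $ a $ b = q * R $ a $ b - (\<Sum>c\<in>UNIV. B $ a $ c * R $ c $ b)"
proof -
  have "((mat q - B) ** R) $ a $ b
      = (\<Sum>c\<in>UNIV. (if a = c then q * R $ c $ b else 0) - B $ a $ c * R $ c $ b)"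
    by (simp add: matrix_matrix_mult_def mat_def left_diff_distrib
        if_distrib[of "\<lambda>x. x * _"] cong: if_cong)
  then show ?thesis by (simp add: sum_subtractf)
qed

text \<open>Minimum principle: the smallest entry of column \<open>b\<close> is at least a row sum
  of \<open>C\<close> times itself, and that row sum is below 1.\<close>

lemma row_substochastic_inverse_nonneg:
  fixes C K :: "real^'n::finite^'n"
  assumes C: "\<And>i j. 0 \<le> C $ i $ j" and rows: "\<And>i. (\<Sum>j\<in>UNIV. C $ i $ j) < 1"
    and K: "(mat 1 - C) ** K = mat 1"
  shows "0 \<le> K $ i $ b"
proof -
  obtain m where m: "\<And>j. K $ m $ b \<le> K $ j $ b"
    using ex_min_if_finite[of "range (\<lambda>j. K $ j $ b)"] by (auto simp: not_less) 
  have "K $ m $ b = (if m = b then 1 else 0) + (\<Sum>c\<in>UNIV. C $ m $ c * K $ c $ b)"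
    using arg_cong[OF K, of "\<lambda>M. M $ m $ b"] unfolding mat_diff_mult_nth by (simp add: mat_def)
  also have "\<dots> \<ge> 0 + (\<Sum>c\<in>UNIV. C $ m $ c * K $ m $ b)"
    by (intro add_mono sum_mono mult_left_mono m C) auto
  finally have "0 \<le> (1 - (\<Sum>c\<in>UNIV. C $ m $ c)) * K $ m $ b"
    by (simp add: left_diff_distrib sum_distrib_right)
  then have "0 \<le> K $ m $ b"
    using rows[of m] by (simp add: zero_le_mult_iff)
  then show ?thesis
    using m[of i] by simp
qed

text \<open>This makes the supremum in \<open>spectral_radius\<close> a true upper bound. The
  eigenvector equation is read at a coordinate of largest modulus.\<close>

lemma eigenvalues_bdd: "bdd_above (cmod ` eigenvalues B)"
proof (rule bdd_aboveI2)
  fix z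
  assume "z \<in> eigenvalues B"
  then obtain v where v: "v \<noteq> 0" "map_matrix complex_of_real B *v v = z *s v"
    by (auto simp: eigenvalues_def)
  have "finite (range (\<lambda>i. cmod (v $ i)))" by simp
  then obtain m where m: "\<And>i. cmod (v $ i) \<le> cmod (v $ m)"
    using Max_in[of "range (\<lambda>i. cmod (v $ i))"] Max_ge[of "range (\<lambda>i. cmod (v $ i))"]
    by (metis (no_types, lifting) UNIV_not_empty image_is_empty imageE rangeI)
  have pos: "0 < cmod (v $ m)"
  proof -
    obtain j where "v $ j \<noteq> 0"
      using v(1) by (auto simp: vec_eq_iff)
    then show ?thesis
      using m[of j] by (metis norm_le_zero_iff not_less order_trans)
  qed
  have "cmod z * cmod (v $ m) = cmod (\<Sum>j\<in>UNIV. complex_of_real (B $ m $ j) * v $ j)"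
    using arg_cong[OF v(2), of "\<lambda>w. cmod (w $ m)"]
    by (simp add: matrix_vector_mult_def map_matrix_def norm_mult)
  also have "\<dots> \<le> (\<Sum>j\<in>UNIV. \<bar>B $ m $ j\<bar> * cmod (v $ j))"
    by (rule order_trans[OF norm_sum]) (simp add: norm_mult)
  also have "\<dots> \<le> (\<Sum>j\<in>UNIV. \<bar>B $ m $ j\<bar>) * cmod (v $ m)"
    unfolding sum_distrib_right by (intro sum_mono mult_left_mono m) auto
  finally have "cmod z \<le> (\<Sum>j\<in>UNIV. \<bar>B $ m $ j\<bar>)"
    using pos by simp
  also have "\<dots> \<le> (\<Sum>i\<in>UNIV. \<Sum>j\<in>UNIV. \<bar>B $ i $ j\<bar>)"
    by (intro member_le_sum) (auto intro: sum_nonneg)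
  finally show "cmod z \<le> (\<Sum>i\<in>UNIV. \<Sum>j\<in>UNIV. \<bar>B $ i $ j\<bar>)" .
qed

lemma invertible_above_spectral_radius:
  fixes B :: "real^'n::finite^'n"
  assumes "spectral_radius B < r"
  shows "invertible (mat r - B)"
proof (rule ccontr)
  assume "\<not> invertible (mat r - B)"
  then obtain v where v: "v \<noteq> 0" "(mat r - B) *v v = 0"
    using matrix_left_invertible_ker[of "mat r - B"] invertible_left_inverse by blast
  have eq: "(\<Sum>j\<in>UNIV. B $ i $ j * v $ j) = r * v $ i" for i
    using arg_cong[OF v(2), of "\<lambda>w. w $ i"]
    by (simp add: matrix_vector_mult_def mat_def left_diff_distrib sum_subtractf
        if_distrib[of "\<lambda>x. x * _"] cong: if_cong)
  have "complex_of_real r \<in> eigenvalues B"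
    unfolding eigenvalues_def mem_Collect_eq
  proof (intro exI conjI)
    show "(\<chi> i. complex_of_real (v $ i)) \<noteq> 0"
      using v(1) by (simp add: vec_eq_iff)
    show "map_matrix complex_of_real B *v (\<chi> i. complex_of_real (v $ i))
        = complex_of_real r *s (\<chi> i. complex_of_real (v $ i))"
      using eq by (simp add: vec_eq_iff matrix_vector_mult_def map_matrix_def
          flip: of_real_mult of_real_sum)
  qed
  then have "cmod (complex_of_real r) \<le> spectral_radius B"
    unfolding spectral_radius_def by (rule cSUP_upper[OF _ eigenvalues_bdd])
  then show False
    using assms by simp
qed

lemma continuous_on_det:
  fixes X :: "real \<Rightarrow> real^'n^'n"
  assumes "\<And>i j. continuous_on S (\<lambda>r. X r $ i $ j)"
  shows "continuous_on S (\<lambda>r. det (X r))"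
  unfolding det_def by (intro continuous_intros assms)

text \<open>The set \<open>E\<close> of all \<open>r \<ge> s\<close> for which the inverse of \<open>r I - B\<close> is nonnegative is closed, contains
all large \<open>r\<close>, and is open to the left, hence contains \<open>s\<close>.\<close>

lemma M_matrix_inverse_nonneg:
  fixes B H :: "real^'n::finite^'n"
  assumes B: "\<And>i j. 0 \<le> B $ i $ j" and s: "spectral_radius B \<le> s"
    and H: "(mat s - B) ** H = mat 1"
  shows "0 \<le> H $ i $ j"
proof -
  define R where "R r = matrix_inv (mat r - B)" for r
  \<comment> \<open>The endpoint \<open>r = s\<close> may equal the spectral radius; there
    \<open>H\<close> provides the inverse.\<close>
  have inv: "invertible (mat r - B)" if "s \<le> r" for r
    using that s H invertible_above_spectral_radius[of B r] invertible_right_inverse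
    by (cases "r = s") auto
  have R: "(mat r - B) ** R r = mat 1" if "s \<le> r" for r
    using inv[OF that] unfolding R_def matrix_inv_def invertible_def by (rule someI2_ex) auto
  have R': "R r ** (mat r - B) = mat 1" if "s \<le> r" for r
    using R[OF that] matrix_left_right_inverse by blast
  \<comment> \<open>Cramer's rule makes the entries quotients of continuous functions, up to the
    endpoint \<open>s\<close>.\<close>
  have entry: "R r $ a $ b = det (\<chi> i j. if j = a then axis b 1 $ i else (mat r - B) $ i $ j)
      / det (mat r - B)" if "s \<le> r" for r a b
  proof -
    have "(mat r - B) *v column b (R r) = column b ((mat r - B) ** R r)"
      by (simp add: vec_eq_iff column_def matrix_vector_mult_def matrix_matrix_mult_def)
    also have "\<dots> = axis b 1"
      unfolding R[OF that] by (simp add: vec_eq_iff column_def mat_def axis_def)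
    finally show ?thesis
      using cramer[of "mat r - B" "column b (R r)" "axis b 1"] inv[OF that]
      by (simp add: vec_eq_iff column_def invertible_det_nz)
  qed
  have cont: "continuous_on {s..} (\<lambda>r. R r $ a $ b)" for a b
  proof -
    have c: "continuous_on {s..} (\<lambda>r. (mat r - B) $ i $ j)" for i j
      by (cases "i = j") (auto simp: mat_def intro!: continuous_intros)
    have "continuous_on {s..} (\<lambda>r. det (\<chi> i j. if j = a then axis b 1 $ i else (mat r - B) $ i $ j)
      / det (mat r - B))"
    proof (intro continuous_on_divide continuous_on_det c)
      show "continuous_on {s..} (\<lambda>r. (\<chi> i j. if j = a then axis b 1 $ i else (mat r - B) $ i $ j) $ i $ j)" for i j
        using c by (cases "j = a") simp_all
    qed (use inv in \<open>simp add: invertible_det_nz\<close>)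
    then show ?thesis
      by (rule continuous_on_cong[THEN iffD1, rotated 2]) (simp_all add: entry)
  qed
  define E where "E = {r. s \<le> r \<and> (\<forall>a b. 0 \<le> R r $ a $ b)}"
  have large: "r \<in> E" if r: "s \<le> r" "0 < r" "\<And>i. (\<Sum>j\<in>UNIV. B $ i $ j) < r" for r
  proof -
    have "(mat 1 - (1 / r) *\<^sub>R B) ** (r *\<^sub>R R r) = (mat r - B) ** R r"
      unfolding vec_eq_iff mat_diff_mult_nth using r by simp
    then have "(mat 1 - (1 / r) *\<^sub>R B) ** (r *\<^sub>R R r) = mat 1"
      using R r by simp
    then have "0 \<le> (r *\<^sub>R R r) $ a $ b" for a b
      by (rule row_substochastic_inverse_nonneg[rotated 2])
        (use B r in \<open>auto simp flip: sum_divide_distrib\<close>)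
    then show ?thesis
      using r by (simp add: E_def zero_le_mult_iff)
  qed
  \<comment> \<open>\<open>(q I - B) R r = I - (r - q) R r\<close> is of the row-substochastic form.
    Its inverse \<open>?X\<close> is therefore nonnegative, and
    \<open>R q = R r ** ?X\<close>.\<close>
  have step: "q \<in> E" if r: "r \<in> E" and q: "s \<le> q" "q \<le> r" "\<And>a. (r - q) * (\<Sum>b\<in>UNIV. R r $ a $ b) < 1" for r q
  proof -
    have rs: "s \<le> r" and R_nonneg: "\<And>a b. 0 \<le> R r $ a $ b"
      using r by (auto simp: E_def)
    let ?X = "(mat r - B) ** R q"
    have "(mat q - B) ** R r = mat 1 - (r - q) *\<^sub>R R r"
    proof -
      have "(\<Sum>c\<in>UNIV. B $ a $ c * R r $ c $ b) = r * R r $ a $ b - (mat 1 :: real^'n^'n) $ a $ b" for a b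
        using arg_cong[OF R[OF rs], of "\<lambda>m. m $ a $ b"] unfolding mat_diff_mult_nth by simp
      then show ?thesis
        unfolding vec_eq_iff mat_diff_mult_nth by (simp add: algebra_simps)
    qed
    then have "(mat 1 - (r - q) *\<^sub>R R r) ** ?X = ((mat q - B) ** R r) ** ?X"
      by simp
    also have "\<dots> = (mat q - B) ** (R r ** (mat r - B)) ** R q"
      by (simp only: matrix_mul_assoc)
    also have "\<dots> = mat 1"
      using R R' rs q by simp
    finally have "0 \<le> ?X $ a $ b" for a b
      by (rule row_substochastic_inverse_nonneg[rotated 2])
        (use R_nonneg q in \<open>simp_all flip: sum_distrib_left\<close>)
    then have "0 \<le> (R r ** ?X) $ a $ b" for a b
      unfolding matrix_matrix_mult_def[of "R r"] vec_lambda_beta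
      by (intro sum_nonneg mult_nonneg_nonneg R_nonneg)
    moreover have "R r ** ?X = R q"
      by (simp add: matrix_mul_assoc R' rs)
    ultimately have "0 \<le> R q $ a $ b" for a b
      by simp
    then show ?thesis
      using q(1) by (simp add: E_def)
  qed
  have closed: "closed E"
  proof -
    have "E = (\<Inter>a. \<Inter>b. {r \<in> {s..}. 0 \<le> R r $ a $ b})"
      by (auto simp: E_def)
    also have "closed \<dots>"
      by (intro closed_INT ballI continuous_on_closed_Collect_le cont continuous_on_const) auto
    finally show ?thesis .
  qed
  have bdd: "bdd_below E"
    by (auto simp: E_def intro!: bdd_belowI[of _ s])
  have ne: "E \<noteq> {}"
  proof -
    define r where "r = 1 + \<bar>s\<bar> + (\<Sum>i\<in>UNIV. \<Sum>j\<in>UNIV. B $ i $ j)"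
    have total: "0 \<le> (\<Sum>i\<in>UNIV. \<Sum>j\<in>UNIV. B $ i $ j)"
      by (intro sum_nonneg B)
    have row: "(\<Sum>j\<in>UNIV. B $ i $ j) \<le> (\<Sum>i\<in>UNIV. \<Sum>j\<in>UNIV. B $ i $ j)" for i
      by (intro member_le_sum[of i UNIV "\<lambda>i. \<Sum>j\<in>UNIV. B $ i $ j"]) (auto intro: sum_nonneg B)
    have "r \<in> E"
    proof (rule large)
      show "s \<le> r" "0 < r"
        using total by (simp_all add: r_def)
      show "(\<Sum>j\<in>UNIV. B $ i $ j) < r" for i
        using row[of i] by (simp add: r_def)
    qed
    then show ?thesis by auto
  qed
  define r where "r = Inf E"
  have rE: "r \<in> E"
    unfolding r_def by (rule closed_contains_Inf[OF ne bdd closed])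
  have "r = s"
  proof (rule ccontr)
    assume "r \<noteq> s"
    then have "s < r" using rE by (auto simp: E_def)
    define S where "S = (\<Sum>a\<in>UNIV. \<Sum>b\<in>UNIV. R r $ a $ b)"
    \<comment> \<open>Then \<open>r - d\<close> stays at or above \<open>s\<close>, while
      \<open>d\<close> times any row sum of \<open>R r\<close> is at most
      \<open>S / (2 (1 + S)) < 1\<close>.\<close>
    define d where "d = min (r - s) (1 / (2 * (1 + S)))"
    have R_nonneg: "0 \<le> R r $ a $ b" for a b
      using rE by (auto simp: E_def)
    have S: "0 \<le> S" "(\<Sum>b\<in>UNIV. R r $ a $ b) \<le> S" for a
      unfolding S_def using member_le_sum[of a UNIV "\<lambda>a. \<Sum>b\<in>UNIV. R r $ a $ b"]
      by (auto intro!: sum_nonneg R_nonneg)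
    have d: "0 < d" "d \<le> r - s"
      using \<open>s < r\<close> S(1) by (auto simp: d_def)
    have "d * (\<Sum>b\<in>UNIV. R r $ a $ b) < 1" for a
    proof -
      have "d * (\<Sum>b\<in>UNIV. R r $ a $ b) \<le> 1 / (2 * (1 + S)) * S"
        using d S by (intro mult_mono) (auto simp: d_def intro!: sum_nonneg R_nonneg)
      also have "\<dots> < 1"
        using S(1) by (simp add: field_simps)
      finally show ?thesis .
    qed
    then have "r - d \<in> E"
      using d by (intro step[OF rE]) auto
    then have "r \<le> r - d"
      unfolding r_def by (rule cInf_lower[OF _ bdd])
    then show False using d by simp
  qed
  then have "s \<in> E" using rE by simp
  then have "0 \<le> R s $ i $ j" by (simp add: E_def)
  moreover have "R s = H"
    by (metis R' H matrix_mul_assoc matrix_mul_lid matrix_mul_rid order_refl)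
  ultimately show ?thesis by simp
qed

lemma inverse_M_matrix_resolvent_setup:
  fixes G :: "real^'n::finite^'n"
  assumes "inverse_M_matrix G"
  obtains s A B where "resolvent_setup s A G B"
proof -
  obtain A s B where A: "invertible A" "G = matrix_inv A" "A = mat s - B"
    and B: "\<And>i j. 0 \<le> B $ i $ j" and s: "spectral_radius B \<le> s"
    using assms unfolding inverse_M_matrix_def M_matrix_def by auto
  have AG: "A ** G = mat 1"
    using A(1) unfolding A(2) matrix_inv_def invertible_def by (rule someI2_ex) auto
  \<comment> \<open>Adding the same multiple of the identity to \<open>s I\<close> and to
    \<open>B\<close> makes the scalar a positive integer, even if \<open>s \<le> 0\<close>.\<close>
  let ?s = "Suc (nat \<lceil>s\<rceil>)"
  have "s \<le> ?s" by linarith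
  then have "resolvent_setup ?s A G (B + mat (?s - s))"
    using AG B M_matrix_inverse_nonneg[OF B s AG[unfolded A(3)]]
    by unfold_locales (auto simp: A(3) mat_def vec_eq_iff)
  then show thesis by (rule that)
qed

section \<open>Monotonicity along the interpolation\<close>

text \<open>Jacobi's formula for \<open>I + \<Lambda> \<Gamma>\<close>, whose inverse at
  \<open>z\<close> is \<open>A ** K UNIV x\<close>; \<open>K_left\<close> computes the entries of
  this inverse.\<close>

lemma (in resolvent_setup) laplace_has_derivative:
  fixes \<Gamma> :: "real \<Rightarrow> real^'n^'n"
  assumes \<Gamma>: "\<Gamma> z = G"
    and der: "\<And>i j. ((\<lambda>u. \<Gamma> u $ i $ j) has_real_derivative \<Gamma>' $ i $ j) (at z)"
    and x: "\<And>i. 0 \<le> x $ i"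
  shows "((\<lambda>u. inverse (det (mat 1 + diag_matrix x ** \<Gamma> u))) has_real_derivative
    (\<Sum>i\<in>UNIV. \<Sum>j\<in>UNIV. - \<Gamma>' $ i $ j *
      (laplace x * (x $ i * ((if i = j then 1 else 0) - x $ j * K UNIV x $ j $ i))))) (at z)"
proof -
  let ?X = "\<lambda>u. mat 1 + diag_matrix x ** \<Gamma> u"
  have nth: "(diag_matrix x ** \<Gamma> u) $ i $ j = x $ i * \<Gamma> u $ i $ j" for u i j
    by (simp add: matrix_matrix_mult_def diag_matrix_def if_distrib[of "\<lambda>x. x * _"] cong: if_cong)
  have dX: "((\<lambda>u. ?X u $ i $ j) has_real_derivative (\<chi> i j. x $ i * \<Gamma>' $ i $ j) $ i $ j) (at z)" for i j
    by (auto simp: nth intro!: derivative_eq_intros der)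
  have GA: "G ** A = mat 1"
    using A_G matrix_left_right_inverse by blast
  have X: "?X z = M UNIV x ** G"
    using M_UNIV_G \<Gamma> x by simp
  have "?X z ** (A ** K UNIV x) = M UNIV x ** (G ** A) ** K UNIV x"
    unfolding X by (simp only: matrix_mul_assoc)
  then have inv: "?X z ** (A ** K UNIV x) = mat 1"
    by (simp add: GA M_K x)
  have AK: "(A ** K UNIV x) $ j $ i = (if i = j then 1 else 0) - x $ j * K UNIV x $ j $ i" for i j
    using K_left[OF x, of j i]
    by (simp add: A_eq mat_diff_mult_nth algebra_simps)
  have nz: "det (?X z) \<noteq> 0"
    using inv invertible_det_nz invertible_right_inverse by blast
  have cancel: "det (?X z) * (inverse (det (?X z)) * w) = w" for w
    using nz by simp
  have lap: "laplace x = inverse (det (?X z))"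
    by (simp add: laplace_def \<Gamma>)
  show ?thesis
    by (rule DERIV_cong[OF DERIV_inverse'[OF has_real_derivative_det[OF dX inv] nz]])
      (simp add: lap AK sum_distrib_left sum_negf mult_ac cancel)
qed

text \<open>The derivative in \<open>\<alpha>\<close> is a sum of terms
  \<open>- G' \<alpha> $ i $ j\<close> times a pairing; the signs of the two factors agree by
  \<open>pairing_diagonal\<close> and \<open>pairing_off_diagonal\<close>. The data
  \<open>s\<close>, \<open>A\<close>, \<open>B\<close> are chosen separately for each
  \<open>\<alpha>\<close>.\<close>

lemma pairing_laplace_mono:
  fixes G G' :: "real \<Rightarrow> real^'n::finite^'n"
  assumes M: "\<And>\<alpha>. \<alpha> \<in> {0..1} \<Longrightarrow> inverse_M_matrix (G \<alpha>)"
    and der: "\<And>i j \<alpha>. \<alpha> \<in> {0..1} \<Longrightarrow>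
      ((\<lambda>\<beta>. G \<beta> $ i $ j) has_real_derivative G' \<alpha> $ i $ j) (at \<alpha> within {0..1})"
    and diag: "\<And>i \<alpha>. \<alpha> \<in> {0..1} \<Longrightarrow> G' \<alpha> $ i $ i \<le> 0"
    and off: "\<And>i j \<alpha>. \<alpha> \<in> {0..1} \<Longrightarrow> i \<noteq> j \<Longrightarrow> 0 \<le> G' \<alpha> $ i $ j"
    and a: "admissible m a"
  shows "pairing m a (\<lambda>x. inverse (det (mat 1 + diag_matrix x ** G 0)))
    \<le> pairing m a (\<lambda>x. inverse (det (mat 1 + diag_matrix x ** G 1)))"
proof (rule DERIV_nonneg_imp_increasing_open[where
      f = "\<lambda>\<alpha>. pairing m a (\<lambda>x. inverse (det (mat 1 + diag_matrix x ** G \<alpha>)))"])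
  have cont: "continuous_on {0..1} (\<lambda>\<alpha>. G \<alpha> $ i $ j)" for i j
    unfolding continuous_on_eq_continuous_within
    using der DERIV_continuous by blast
  show "continuous_on {0..1} (\<lambda>\<alpha>. pairing m a (\<lambda>x. inverse (det (mat 1 + diag_matrix x ** G \<alpha>))))"
    unfolding pairing_def
  proof (intro continuous_on_sum continuous_on_mult continuous_on_const continuous_on_inverse
      continuous_on_det ballI)
    fix k :: "'n \<Rightarrow> nat" and i j
    show "continuous_on {0..1} (\<lambda>\<alpha>. (mat 1 + diag_matrix (\<chi> i. real (k i)) ** G \<alpha>) $ i $ j)"
      unfolding vector_add_component matrix_matrix_mult_def vec_lambda_beta
      by (intro continuous_intros cont)
  next
    fix k :: "'n \<Rightarrow> nat" and \<alpha> :: real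
    assume "\<alpha> \<in> {0..1}"
    then obtain s A B where "resolvent_setup s A (G \<alpha>) B"
      using inverse_M_matrix_resolvent_setup[OF M] by blast
    then interpret resolvent_setup s A "G \<alpha>" B .
    let ?x = "\<chi> i. real (k i)"
    have "det A * det (G \<alpha>) = 1"
      using arg_cong[OF A_G, of det] by (simp add: det_mul)
    then show "det (mat 1 + diag_matrix ?x ** G \<alpha>) \<noteq> 0"
      using det_M_nz[of ?x UNIV] M_UNIV_G[of ?x] by (auto simp: det_mul dest!: arg_cong[of _ _ det])
  qed
next
  fix \<alpha> :: real
  assume \<alpha>: "0 < \<alpha>" "\<alpha> < 1"
  then obtain s A B where "resolvent_setup s A (G \<alpha>) B"
    using inverse_M_matrix_resolvent_setup[OF M] by (metis atLeastAtMost_iff less_imp_le)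
  then interpret resolvent_setup s A "G \<alpha>" B .
  have d: "((\<lambda>\<beta>. G \<beta> $ i $ j) has_real_derivative G' \<alpha> $ i $ j) (at \<alpha>)" for i j
    using der[of \<alpha> i j] \<alpha> by (simp add: at_within_Icc_at)
  let ?D = "\<lambda>i j x. laplace x * (x $ i * ((if i = j then 1 else 0) - x $ j * K UNIV x $ j $ i))"
  let ?d = "pairing m a (\<lambda>x. \<Sum>i\<in>UNIV. \<Sum>j\<in>UNIV. - G' \<alpha> $ i $ j * ?D i j x)"
  show "\<exists>y. ((\<lambda>\<alpha>. pairing m a (\<lambda>x. inverse (det (mat 1 + diag_matrix x ** G \<alpha>))))
      has_real_derivative y) (at \<alpha>) \<and> 0 \<le> y"
  proof (intro exI conjI)
    show "((\<lambda>\<alpha>. pairing m a (\<lambda>x. inverse (det (mat 1 + diag_matrix x ** G \<alpha>))))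
        has_real_derivative ?d) (at \<alpha>)"
      unfolding pairing_def
      by (intro DERIV_sum DERIV_cmult laplace_has_derivative d refl) simp
    have "0 \<le> - G' \<alpha> $ i $ j * pairing m a (?D i j)" for i j
    proof (cases "i = j")
      case True
      then show ?thesis
        using pairing_diagonal[OF a, of i] diag[of \<alpha> i] \<alpha> by (simp add: mult_nonpos_nonneg)
    next
      case False
      have "pairing m a (?D i j) = - pairing m a (\<lambda>x. laplace x * (x $ i * (x $ j * K UNIV x $ j $ i)))"
        using False pairing_cmult[of m a "-1"] by simp
      then show ?thesis
        using pairing_off_diagonal[OF a False] off[of \<alpha> i j] False \<alpha> by simp
    qed
    then show "0 \<le> ?d"
      unfolding pairing_sum pairing_cmult by (intro sum_nonneg)
  qed
qed simp

section \<open>From Laplace transforms to the supremum\<close>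

text \<open>The polynomials \<open>1 - (1 - z\<^sup>r)\<^sup>b\<close> with \<open>b\<close> about \<open>1 / (r c\<^sup>r)\<close>: then \<open>b z\<^sup>r\<close> tends to \<open>0\<close> for
\<open>z \<le> c\<close> (including \<open>z = c\<close>) and to \<open>\<infinity>\<close> for \<open>z > c\<close>.\<close>

lemma step_polynomials:
  fixes c :: real
  assumes c: "0 < c" "c < 1"
  obtains m :: "nat \<Rightarrow> nat" and a :: "nat \<Rightarrow> nat \<Rightarrow> real"
  where "\<And>n. admissible (m n) (a n)"
    and "\<And>n z. z \<in> {0..1} \<Longrightarrow> (\<Sum>k\<le>m n. a n k * z ^ k) \<in> {0..1}"
    and "\<And>z. z \<in> {0..1} \<Longrightarrow> (\<lambda>n. \<Sum>k\<le>m n. a n k * z ^ k) \<longlonglongrightarrow> (if c < z then 1 else 0)"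
proof -
  define b where "b n = nat \<lceil>1 / (real (Suc n) * c ^ Suc n)\<rceil>" for n
  define P :: "nat \<Rightarrow> real poly" where "P n = 1 - (1 - monom 1 (Suc n)) ^ b n" for n
  define p where "p n z = 1 - (1 - z ^ Suc n) ^ b n" for n and z :: real
  have b: "1 / (real (Suc n) * c ^ Suc n) \<le> b n" "b n \<le> 1 / (real (Suc n) * c ^ Suc n) + 1" for n
    unfolding b_def using c by (simp_all add: of_nat_nat)
  have p: "(\<Sum>k\<le>degree (P n). coeff (P n) k * z ^ k) = p n z" for n and z :: real
    unfolding poly_altdef[symmetric] by (simp add: P_def p_def poly_monom)
  have "admissible (degree (P n)) (coeff (P n))" for n
    unfolding admissible_def
  proof (intro conjI ballI)
    show "0 \<le> coeff (P n) 0"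
      by (simp flip: poly_0_coeff_0 add: P_def poly_monom)
    fix z :: real
    assume z: "z \<in> {0<..1}"
    have "poly (pderiv (P n)) z = b n * (1 - z ^ Suc n) ^ (b n - 1) * (real (Suc n) * z ^ n)"
    proof (rule DERIV_unique)
      show "DERIV (poly (P n)) z :> poly (pderiv (P n)) z"
        by (rule poly_DERIV)
      have "poly (P n) = p n"
        by (auto simp: P_def p_def poly_monom)
      then show "DERIV (poly (P n)) z :> b n * (1 - z ^ Suc n) ^ (b n - 1) * (real (Suc n) * z ^ n)"
        unfolding p_def by (auto intro!: derivative_eq_intros simp del: power_Suc)
    qed
    moreover have "0 \<le> b n * (1 - z ^ Suc n) ^ (b n - 1) * (real (Suc n) * z ^ n)"
      using z by (intro mult_nonneg_nonneg zero_le_power) (auto simp: power_le_one simp del: power_Suc)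
    moreover have "(\<Sum>k\<le>degree (P n). real k * coeff (P n) k * z ^ k) = z * poly (pderiv (P n)) z"
    proof -
      have "DERIV (\<lambda>z. \<Sum>k\<le>degree (P n). coeff (P n) k * z ^ k) z
          :> (\<Sum>k\<le>degree (P n). coeff (P n) k * (real k * z ^ (k - 1)))"
        by (auto intro!: derivative_eq_intros sum.cong)
      then have "poly (pderiv (P n)) z = (\<Sum>k\<le>degree (P n). coeff (P n) k * (real k * z ^ (k - 1)))"
        by (intro DERIV_unique[OF poly_DERIV]) (simp add: poly_altdef)
      then show ?thesis
        by (auto simp: sum_distrib_left power_eq_if[of z] intro!: sum.cong)
    qed
    ultimately show "0 \<le> (\<Sum>k\<le>degree (P n). real k * coeff (P n) k * z ^ k)"
      using z by simp
  qed
  moreover have p_bounds: "p n z \<in> {0..1}" if "z \<in> {0..1}" for n and z :: real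
    using that unfolding p_def
    by (auto intro!: power_le_one zero_le_power simp: power_le_one simp del: power_Suc)
  moreover have "(\<lambda>n. p n z) \<longlonglongrightarrow> (if c < z then 1 else 0)" if z: "z \<in> {0..1}" for z :: real
  proof (cases "c < z")
    case False
    have lim: "(\<lambda>n. 1 / real (Suc n) + c ^ Suc n) \<longlonglongrightarrow> 0 + 0"
      using c by (intro tendsto_add LIMSEQ_Suc[OF LIMSEQ_power_zero] LIMSEQ_Suc[OF lim_1_over_n]) auto
    have "p n z \<le> 1 / real (Suc n) + c ^ Suc n" for n
    proof -
      \<comment> \<open>Bernoulli's inequality bounds \<open>p n z\<close> by
        \<open>b n * z ^ Suc n\<close>. The factor \<open>1 / Suc n\<close> in \<open>b n\<close>
        gives the limit 0 even at \<open>z = c\<close>.\<close>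
      have "1 + b n * (- (z ^ Suc n)) \<le> (1 + - (z ^ Suc n)) ^ b n"
        using z by (intro Bernoulli_inequality) (simp add: power_le_one del: power_Suc)
      then have "p n z \<le> b n * z ^ Suc n"
        by (simp add: p_def del: power_Suc)
      also have "\<dots> \<le> (1 / (real (Suc n) * c ^ Suc n) + 1) * c ^ Suc n"
        using False z c b by (intro mult_mono power_mono) (auto simp del: power_Suc of_nat_Suc)
      also have "\<dots> = 1 / real (Suc n) + c ^ Suc n"
        using c by (simp add: distrib_right del: power_Suc of_nat_Suc)
      finally show ?thesis .
    qed
    then have upper: "\<forall>\<^sub>F n in sequentially. p n z \<le> 1 / real (Suc n) + c ^ Suc n"
      by (rule always_eventually[OF allI])
    have lower: "\<forall>\<^sub>F n in sequentially. 0 \<le> p n z"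
      using p_bounds[OF z] by (intro always_eventually allI) auto
    have "(\<lambda>n. p n z) \<longlonglongrightarrow> 0"
      by (rule tendsto_sandwich[OF lower upper tendsto_const]) (use lim in simp)
    then show ?thesis using False by simp
  next
    case True
    have "(\<lambda>n. real n / (z / c) ^ n) \<longlonglongrightarrow> 0"
      using True c by (intro lim_n_over_pown) simp
    then have lim: "(\<lambda>n. real (Suc n) / (z / c) ^ Suc n) \<longlonglongrightarrow> 0"
      by (rule LIMSEQ_Suc)
    have "1 - real (Suc n) / (z / c) ^ Suc n \<le> p n z" for n
    proof -
      \<comment> \<open>A lower bound for \<open>b n * z ^ Suc n\<close> that grows geometrically up
        to a linear factor; then \<open>1 - p n z \<le> exp (- y) \<le> 1 / y\<close>.\<close>
      define y where "y = (z / c) ^ Suc n / real (Suc n)"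
      have y: "0 < y"
        using True c by (simp add: y_def del: power_Suc of_nat_Suc)
      have "y = 1 / (real (Suc n) * c ^ Suc n) * z ^ Suc n"
        by (simp add: y_def power_divide del: power_Suc of_nat_Suc)
      also have "\<dots> \<le> b n * z ^ Suc n"
        using z b by (intro mult_right_mono) (auto simp del: power_Suc of_nat_Suc)
      finally have yb: "y \<le> b n * z ^ Suc n" .
      have "(1 - z ^ Suc n) ^ b n \<le> exp (- (z ^ Suc n)) ^ b n"
        using z exp_ge_add_one_self[of "- (z ^ Suc n)"]
        by (intro power_mono) (auto simp: power_le_one simp del: power_Suc)
      also have "\<dots> = exp (- (b n * z ^ Suc n))"
        by (simp flip: exp_of_nat_mult del: power_Suc)
      also have "\<dots> \<le> exp (- y)"
        using yb by simp
      also have "\<dots> \<le> 1 / y"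
      proof -
        have "y \<le> exp y"
          using exp_ge_add_one_self[of y] by linarith
        then show ?thesis
          using y by (simp add: exp_minus inverse_eq_divide frac_le)
      qed
      also have "\<dots> = real (Suc n) / (z / c) ^ Suc n"
        by (simp add: y_def del: power_Suc of_nat_Suc)
      finally show ?thesis by (simp add: p_def del: power_Suc of_nat_Suc)
    qed
    then have lower: "\<forall>\<^sub>F n in sequentially. 1 - real (Suc n) / (z / c) ^ Suc n \<le> p n z"
      by (rule always_eventually[OF allI])
    have upper: "\<forall>\<^sub>F n in sequentially. p n z \<le> 1"
      using p_bounds[OF z] by (intro always_eventually allI) auto
    have "(\<lambda>n. 1 - real (Suc n) / (z / c) ^ Suc n) \<longlonglongrightarrow> 1"
      using tendsto_diff[OF tendsto_const lim, of 1] by (simp del: power_Suc of_nat_Suc)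
    then have "(\<lambda>n. p n z) \<longlonglongrightarrow> 1"
      by (rule tendsto_sandwich[OF lower upper _ tendsto_const])
    then show ?thesis using True by simp
  qed
  ultimately show thesis
    using that[of "\<lambda>n. degree (P n)" "\<lambda>n. coeff (P n)"] by (simp add: p)
qed

text \<open>Expanding the product leaves exponentials of linear forms in \<open>l\<close> with
  natural coefficients, whose expectations are Laplace transform values.\<close>

lemma permanental_vector_pairing:
  fixes l :: "'a \<Rightarrow> real^'n::finite"
  assumes l: "permanental_vector M l G"
  shows "(\<integral>\<omega>. (\<Prod>i\<in>UNIV. \<Sum>k\<le>m. a k * exp (- (l \<omega> $ i)) ^ k) \<partial>M)
    = pairing m a (\<lambda>x. inverse (det (mat 1 + diag_matrix x ** G)))"
proof -
  interpret prob_space M using l by (simp add: permanental_vector_def)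
  have [measurable]: "l \<in> borel_measurable M"
    using l by (simp add: permanental_vector_def)
  let ?x = "\<lambda>k. \<chi> i. real (k i)"
  have eq: "(\<Prod>i\<in>UNIV. \<Sum>k\<le>m. a k * exp (- (l \<omega> $ i)) ^ k)
      = (\<Sum>k\<in>Pi\<^sub>E UNIV (\<lambda>_. {..m}). (\<Prod>i\<in>UNIV. a (k i)) * exp (- (?x k \<bullet> l \<omega>)))" for \<omega>
    by (simp add: prod_sum_PiE prod.distrib inner_vec_def exp_sum sum_negf[symmetric]
        flip: exp_of_nat_mult)
  have int: "integrable M (\<lambda>\<omega>. exp (- (?x k \<bullet> l \<omega>)))" for k
  proof (rule integrable_const_bound)
    have "AE \<omega> in M. \<forall>i. 0 \<le> l \<omega> $ i"
      using l by (simp add: permanental_vector_def)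
    then show "AE \<omega> in M. norm (exp (- (?x k \<bullet> l \<omega>))) \<le> 1"
      by eventually_elim (simp add: inner_vec_def sum_nonneg)
  qed measurable
  have "(\<integral>\<omega>. exp (- (?x k \<bullet> l \<omega>)) \<partial>M) = inverse (det (mat 1 + diag_matrix (?x k) ** G))" for k
    using l unfolding permanental_vector_def by simp
  then show ?thesis
    unfolding eq pairing_def by (simp add: int)
qed

text \<open>Dominated convergence with bound 1. The strict jump at \<open>exp (- y)\<close> selects
  exactly the event that all coordinates are below \<open>y\<close>.\<close>

lemma permanental_vector_sup_limit:
  fixes l :: "'a \<Rightarrow> real^'n::finite"
  assumes l: "permanental_vector M l G"
    and bound: "\<And>n z. z \<in> {0..1} \<Longrightarrow> (\<Sum>k\<le>m n. a n k * z ^ k) \<in> {0..1}"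
    and lim: "\<And>z. z \<in> {0..1} \<Longrightarrow> (\<lambda>n. \<Sum>k\<le>m n. a n k * z ^ k) \<longlonglongrightarrow> (if exp (- y) < z then 1 else 0)"
  shows "(\<lambda>n. pairing (m n) (a n) (\<lambda>x. inverse (det (mat 1 + diag_matrix x ** G))))
    \<longlonglongrightarrow> \<P>(\<omega> in M. (SUP i. l \<omega> $ i) < y)"
proof -
  interpret prob_space M using l by (simp add: permanental_vector_def)
  have [measurable]: "l \<in> borel_measurable M"
    using l by (simp add: permanental_vector_def)
  have [measurable]: "(\<lambda>\<omega>. l \<omega> $ i) \<in> borel_measurable M" for i
    by (simp add: cart_eq_inner_axis)
  have nonneg: "AE \<omega> in M. \<forall>i. 0 \<le> l \<omega> $ i"
    using l by (simp add: permanental_vector_def)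
  have "(\<lambda>n. \<integral>\<omega>. (\<Prod>i\<in>UNIV. \<Sum>k\<le>m n. a n k * exp (- (l \<omega> $ i)) ^ k) \<partial>M)
      \<longlonglongrightarrow> (\<integral>\<omega>. (\<Prod>i\<in>UNIV. if exp (- y) < exp (- (l \<omega> $ i)) then 1 else 0) \<partial>M)"
  proof (rule integral_dominated_convergence[where w = "\<lambda>_. 1"])
    show "AE \<omega> in M. (\<lambda>n. \<Prod>i\<in>UNIV. \<Sum>k\<le>m n. a n k * exp (- (l \<omega> $ i)) ^ k)
        \<longlonglongrightarrow> (\<Prod>i\<in>UNIV. if exp (- y) < exp (- (l \<omega> $ i)) then 1 else 0)"
      using nonneg by eventually_elim (intro tendsto_prod lim, simp)
    show "AE \<omega> in M. norm (\<Prod>i\<in>UNIV. \<Sum>k\<le>m n. a n k * exp (- (l \<omega> $ i)) ^ k) \<le> 1" for n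
      using nonneg
    proof eventually_elim
      case (elim \<omega>)
      then show ?case
        unfolding prod_norm[symmetric] using bound[of "exp (- (l \<omega> $ _))"]
        by (intro prod_le_1) auto
    qed
  qed simp_all
  also have "(\<integral>\<omega>. (\<Prod>i\<in>UNIV. if exp (- y) < exp (- (l \<omega> $ i)) then 1 else 0 :: real) \<partial>M)
      = (\<integral>\<omega>. indicator {\<omega> \<in> space M. (SUP i. l \<omega> $ i) < y} \<omega> \<partial>M)"
  proof (rule Bochner_Integration.integral_cong[OF refl])
    fix \<omega> assume "\<omega> \<in> space M"
    moreover have "(SUP i. l \<omega> $ i) < y \<longleftrightarrow> (\<forall>i. l \<omega> $ i < y)"
      by (subst finite_Sup_less_iff) auto
    moreover have "(\<Prod>i\<in>UNIV. if exp (- y) < exp (- (l \<omega> $ i)) then 1 else 0 :: real)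
        = (if \<forall>i. l \<omega> $ i < y then 1 else 0)"
      by (auto intro!: prod.neutral prod_zero)
    ultimately show "(\<Prod>i\<in>UNIV. if exp (- y) < exp (- (l \<omega> $ i)) then 1 else 0 :: real)
        = indicator {\<omega> \<in> space M. (SUP i. l \<omega> $ i) < y} \<omega>"
      by simp
  qed
  also have "\<dots> = \<P>(\<omega> in M. (SUP i. l \<omega> $ i) < y)"
    by simp
  finally show ?thesis
    by (simp add: permanental_vector_pairing[OF l])
qed

text \<open>Covers the levels for which \<open>exp (- y)\<close> is outside the range of
  \<open>step_polynomials\<close>.\<close>

lemma permanental_vector_sup_nonneg:
  fixes l :: "'a \<Rightarrow> real^'n::finite"
  assumes l: "permanental_vector M l G" and y: "y \<le> 0"
  shows "\<P>(\<omega> in M. (SUP i. l \<omega> $ i) < y) = 0"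
proof -
  interpret prob_space M using l by (simp add: permanental_vector_def)
  have "AE \<omega> in M. \<forall>i. 0 \<le> l \<omega> $ i"
    using l by (simp add: permanental_vector_def)
  then have "AE \<omega> in M. \<not> (SUP i. l \<omega> $ i) < y"
  proof eventually_elim
    case (elim \<omega>)
    then show ?case
      using y by (subst finite_Sup_less_iff) (auto simp: not_less intro: order_trans)
  qed
  then show ?thesis
    by (rule prob_eq_0_AE)
qed

lemma permanental_vector_sup_complement:
  fixes l :: "'a \<Rightarrow> real^'n::finite"
  assumes "permanental_vector M l G"
  shows "\<P>(\<omega> in M. x \<le> (SUP i. l \<omega> $ i)) = 1 - \<P>(\<omega> in M. (SUP i. l \<omega> $ i) < x)"
proof -
  interpret prob_space M using assms by (simp add: permanental_vector_def)
  have [measurable]: "l \<in> borel_measurable M"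
    using assms by (simp add: permanental_vector_def)
  have "(SUP i. l \<omega> $ i) < x \<longleftrightarrow> (\<forall>i. l \<omega> $ i < x)" for \<omega>
    by (subst finite_Sup_less_iff) auto
  then have "{\<omega> \<in> space M. (SUP i. l \<omega> $ i) < x} \<in> events"
    by simp
  then show ?thesis
    using prob_neg[of "\<lambda>\<omega>. (SUP i. l \<omega> $ i) < x"] by (simp add: not_less)
qed

text \<open>If the constant sign is nonpositive, \<open>g 0 \<le> g 1\<close> forces
  \<open>g\<close> to be constant, and the derivative vanishes, also one-sidedly at the
  endpoints.\<close>

lemma constant_sign_derivative_nonneg:
  fixes g g' :: "real \<Rightarrow> real"
  assumes der: "\<And>x. x \<in> {0..1} \<Longrightarrow> (g has_real_derivative g' x) (at x within {0..1})"
    and sign: "(\<forall>x\<in>{0..1}. 0 \<le> g' x) \<or> (\<forall>x\<in>{0..1}. g' x \<le> 0)"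
    and le: "g 0 \<le> g 1" and x: "x \<in> {0..1}"
  shows "0 \<le> g' x"
  using sign
proof
  assume neg: "\<forall>x\<in>{0..1}. g' x \<le> 0"
  have anti: "g v \<le> g u" if "0 \<le> u" "u \<le> v" "v \<le> 1" for u v
  proof (rule DERIV_nonpos_imp_decreasing_open[OF \<open>u \<le> v\<close>])
    show "\<exists>d. (g has_real_derivative d) (at y) \<and> d \<le> 0" if "u < y" "y < v" for y
      using that \<open>0 \<le> u\<close> \<open>v \<le> 1\<close> der[of y] neg by (auto simp: at_within_Icc_at)
    have "continuous_on {0..1} g"
      unfolding continuous_on_eq_continuous_within using der DERIV_continuous by blast
    then show "continuous_on {u..v} g"
      by (rule continuous_on_subset) (use that in auto)
  qed
  have const: "g y = g 0" if "y \<in> {0..1}" for y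
    using anti[of 0 y] anti[of y 1] le that by simp
  have "(g has_real_derivative 0) (at x within {0..1})"
    by (rule has_field_derivative_transform_within[OF DERIV_const[of "g 0"] zero_less_one x])
      (erule const[symmetric])
  then have "g' x = 0"
    using vector_derivative_unique_within_closed_interval[of 0 1 x g "g' x" 0] der[OF x] x
    by (auto simp: has_real_derivative_iff_has_vector_derivative)
  then show ?thesis by simp
qed (use x in blast)

theorem theorem4p3:
  fixes G G' :: "real \<Rightarrow> real^'n^'n"
    and M0 :: "'a measure" and M1 :: "'b measure"
    and l0 :: "'a \<Rightarrow> real^'n" and l1 :: "'b \<Rightarrow> real^'n"
  assumes "\<And>\<alpha>. \<alpha> \<in> {0..1} \<Longrightarrow> inverse_M_matrix (G \<alpha>)"
    and "\<And>\<alpha>. \<alpha> \<in> {0..1} \<Longrightarrow> positive_definite (symmetric_part (G \<alpha>))"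
    and "\<And>i j \<alpha>. \<alpha> \<in> {0..1} \<Longrightarrow>
           ((\<lambda>\<beta>. G \<beta> $ i $ j) has_real_derivative G' \<alpha> $ i $ j) (at \<alpha> within {0..1})"
    and "\<And>i j. continuous_on {0..1} (\<lambda>\<alpha>. G' \<alpha> $ i $ j)"
    and "\<And>i j. (\<forall>\<alpha>\<in>{0..1}. 0 \<le> G' \<alpha> $ i $ j) \<or> (\<forall>\<alpha>\<in>{0..1}. G' \<alpha> $ i $ j \<le> 0)"
    and "permanental_vector M0 l0 (G 0)"
    and "permanental_vector M1 l1 (G 1)"
    and "\<And>i. G 1 $ i $ i \<le> G 0 $ i $ i"
    and "\<And>i j. i \<noteq> j \<Longrightarrow> G 0 $ i $ j \<le> G 1 $ i $ j"
  shows "stochastically_dominates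
           M0 (\<lambda>\<omega>. SUP i. l0 \<omega> $ i) M1 (\<lambda>\<omega>. SUP i. l1 \<omega> $ i)"
proof -
  have diag: "G' \<alpha> $ i $ i \<le> 0" if "\<alpha> \<in> {0..1}" for i \<alpha>
  proof -
    have "0 \<le> - G' \<alpha> $ i $ i"
    proof (rule constant_sign_derivative_nonneg[of "\<lambda>\<beta>. - G \<beta> $ i $ i" "\<lambda>\<beta>. - G' \<beta> $ i $ i"])
      show "((\<lambda>\<beta>. - G \<beta> $ i $ i) has_real_derivative - G' x $ i $ i) (at x within {0..1})"
        if "x \<in> {0..1}" for x
        by (rule DERIV_minus[OF assms(3)[OF that]])
    qed (use assms(5)[of i i] assms(8)[of i] that in auto)
    then show ?thesis by simp
  qed
  have off: "0 \<le> G' \<alpha> $ i $ j" if "\<alpha> \<in> {0..1}" "i \<noteq> j" for i j \<alpha>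
    using constant_sign_derivative_nonneg[of "\<lambda>\<beta>. G \<beta> $ i $ j" "\<lambda>\<beta>. G' \<beta> $ i $ j" \<alpha>]
      assms(3)[of _ i j] assms(5)[of i j] assms(9)[of i j] that
    by blast
  \<comment> \<open>Domination is proved through the complementary events, whose probabilities are
    limits of pairings.\<close>
  have less: "\<P>(\<omega> in M0. (SUP i. l0 \<omega> $ i) < y) \<le> \<P>(\<omega> in M1. (SUP i. l1 \<omega> $ i) < y)" for y
  proof (cases "0 < y")
    case True
    obtain m a where adm: "\<And>n. admissible (m n) (a n)"
      and poly: "\<And>n z. z \<in> {0..1} \<Longrightarrow> (\<Sum>k\<le>m n. a n k * z ^ k) \<in> {0..1}"
        "\<And>z. z \<in> {0..1} \<Longrightarrow> (\<lambda>n. \<Sum>k\<le>m n. a n k * z ^ k) \<longlonglongrightarrow> (if exp (- y) < z then 1 else 0)"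
      using step_polynomials[of "exp (- y)"] True by auto
    show ?thesis
    proof (rule LIMSEQ_le)
      show "(\<lambda>n. pairing (m n) (a n) (\<lambda>x. inverse (det (mat 1 + diag_matrix x ** G 0))))
          \<longlonglongrightarrow> \<P>(\<omega> in M0. (SUP i. l0 \<omega> $ i) < y)"
        by (rule permanental_vector_sup_limit[OF assms(6) poly])
      show "(\<lambda>n. pairing (m n) (a n) (\<lambda>x. inverse (det (mat 1 + diag_matrix x ** G 1))))
          \<longlonglongrightarrow> \<P>(\<omega> in M1. (SUP i. l1 \<omega> $ i) < y)"
        by (rule permanental_vector_sup_limit[OF assms(7) poly])
    qed (use pairing_laplace_mono[OF assms(1,3) diag off adm] in auto)
  next
    case False
    then show ?thesis
      by (simp add: permanental_vector_sup_nonneg[OF assms(6)])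
  qed
  then show ?thesis
    by (simp add: stochastically_dominates_def permanental_vector_sup_complement[OF assms(6)]
        permanental_vector_sup_complement[OF assms(7)])
qed

end
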